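(* Let $(E,\mathcal L)$ be a labelled graph such that $E$ has no sinks and such that $(E,\mathcal L,\mathcal B)$ is set-finite and receiver set-finite for any accommodating set $\mathcal B$ under consideration, and suppose that $(E,\mathcal L,\mathcal E^{0,-})$ and $(E,\mathcal L,\overline{\mathcal E})$ are weakly left-resolving labelled spaces. Then $C^*(E,\mathcal L,\mathcal E^{0,-})\cong C^*(E,\mathcal L,\overline{\mathcal E})$.
   Context: A directed graph $E=(E^0,E^1,r,s)$ has countable sets $E^0$ (vertices), $E^1$ (edges) and range, source maps $r,s:E^1\to E^0$; $E$ has no sinks if every vertex emits an edge. $E^n$ is the set of paths $\lambda=\lambda_1\cdots\lambda_n$ ($r(\lambda_i)=s(\lambda_{i+1})$), $E^{\ge1}=\bigcup_{n\ge1}E^n$, and $r,s$ extend to paths. A labelled graph $(E,\mathcal L)$ over a countable alphabet $\mathcal A$ has a surjective labelling map $\mathcal L:E^1\to\mathcal A$, extended to paths by concatenation; $\mathcal L^*(E)=\mathcal L(E^{\ge1})$. For $\alpha\in\mathcal L^*(E)$ and $A\subset E^0$, $r(\alpha)=\{r(\lambda):\mathcal L(\lambda)=\alpha\}$ and $r(A,\alpha)=\{r(\lambda):\mathcal L(\lambda)=\alpha,\ s(\lambda)\in A\}$. A collection $\mathcal B\subset 2^{E^0}$ is accommodating for $(E,\mathcal L)$ if it contains $r(\alpha)$ for all $\alpha\in\mathcal L^*(E)$ and is closed under $A\mapsto r(A,\alpha)$, finite unions and finite intersections (with $\emptyset$ included in $\mathcal B$ by convention); then $(E,\mathcal L,\mathcal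 B)$ is a labelled space. It is weakly left-resolving if $r(A,\alpha)\cap r(B,\alpha)=r(A\cap B,\alpha)$ for all $A,B\in\mathcal B$, $\alpha\in\mathcal L^*(E)$. With $AE^1=\{e\in E^1:s(e)\in A\}$, $E^1A=\{e\in E^1:r(e)\in A\}$, it is set-finite (receiver set-finite) if $\mathcal L(AE^1)$ ($\mathcal L(E^1A)$) is finite for all $A\in\mathcal B$. $\mathcal E^{0,-}$ is the smallest accommodating set for $(E,\mathcal L)$; $\overline{\mathcal E}$ is the smallest among the accommodating sets $\mathcal B$ for $(E,\mathcal L)$ such that $A\setminus B\in\mathcal B$ whenever $A,B\in\mathcal B$. A representation of a weakly left-resolving labelled space $(E,\mathcal L,\mathcal B)$ consists of projections $\{p_A:A\in\mathcal B\}$ and partial isometries $\{s_a:a\in\mathcal A\}$ with: (i) $p_\emptyset=0$, $p_Ap_B=p_{A\cap B}$, $p_{A\cup B}=p_A+p_B-p_{A\cap B}$; (ii) $p_As_a=s_ap_{r(A,a)}$; (iii) $s_a^*s_a=p_{r(a)}$ and $s_a^*s_b=0$ unless $a=b$; (iv) if $\mathcal L(AE^1)$ is finite and non-empty, $p_A=\sum_{a\in\mathcal L(AE^1)}s_ap_{r(A,a)}s_a^*$. $C^*(E,\mathcal L,\mathcal B)$ is the $C^*$-algebra generated by a universal representation. Here the accommodating sets under consideration are $\mathcal E^{0,-}$ and $\overline{\mathcal E}$. *)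

theory Defs
  imports Complex_Main "HOL-Library.Countable_Set" "HOL-Algebra.Module" "Graph_Theory.Arc_Walk"
begin

section \<open>Labelled graphs and labelled spaces\<close>

text \<open>
  Directed graphs are those of the Graph Theory library: the source map is \<^const>\<open>tail\<close>, the
  range map is \<^const>\<open>head\<close>. Loops, parallel edges and infinitely many vertices and edges are
  allowed. The alphabet is the set \<open>Al\<close>.
\<close>

locale labelled_graph = wf_digraph E
  for E :: "('v, 'e) pre_digraph" (structure) +
  fixes L :: "'e \<Rightarrow> 'l" and Al :: "'l set"
  assumes countable_verts: "countable (verts E)"
    and countable_arcs: "countable (arcs E)"
    and countable_alphabet: "countable Al"
    and label_surj: "L ` arcs E = Al"

definition no_sinks :: "('v, 'e) pre_digraph \<Rightarrow> bool" where
  "no_sinks E \<longleftrightarrow> (\<forall>v\<in>verts E. \<exists>e\<in>arcs E. tail E e = v)"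

text \<open>The set \<open>\<L>\<^sup>*(E)\<close>; an arc walk may be the empty list, which is excluded here.\<close>

definition label_words :: "('v, 'e) pre_digraph \<Rightarrow> ('e \<Rightarrow> 'l) \<Rightarrow> 'l list set" where
  "label_words E L = {map L p |p u v. p \<noteq> [] \<and> pre_digraph.awalk E u p v}"

definition word_range :: "('v, 'e) pre_digraph \<Rightarrow> ('e \<Rightarrow> 'l) \<Rightarrow> 'l list \<Rightarrow> 'v set" where
  "word_range E L \<alpha> = {v. \<exists>p u. p \<noteq> [] \<and> pre_digraph.awalk E u p v \<and> map L p = \<alpha>}"

definition rel_range :: "('v, 'e) pre_digraph \<Rightarrow> ('e \<Rightarrow> 'l) \<Rightarrow> 'v set \<Rightarrow> 'l list \<Rightarrow> 'v set" where
  "rel_range E L A \<alpha> =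
    {v. \<exists>p u. p \<noteq> [] \<and> pre_digraph.awalk E u p v \<and> map L p = \<alpha> \<and> u \<in> A}"

definition accommodating :: "('v, 'e) pre_digraph \<Rightarrow> ('e \<Rightarrow> 'l) \<Rightarrow> 'v set set \<Rightarrow> bool" where
  "accommodating E L B \<longleftrightarrow>
     B \<subseteq> Pow (verts E) \<and>
     {} \<in> B \<and>
     (\<forall>\<alpha>\<in>label_words E L. word_range E L \<alpha> \<in> B) \<and>
     (\<forall>X\<in>B. \<forall>\<alpha>\<in>label_words E L. rel_range E L X \<alpha> \<in> B) \<and>
     (\<forall>X\<in>B. \<forall>Y\<in>B. X \<union> Y \<in> B) \<and>
     (\<forall>X\<in>B. \<forall>Y\<in>B. X \<inter> Y \<in> B)"

definition weakly_left_resolving ::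
    "('v, 'e) pre_digraph \<Rightarrow> ('e \<Rightarrow> 'l) \<Rightarrow> 'v set set \<Rightarrow> bool" where
  "weakly_left_resolving E L B \<longleftrightarrow>
     (\<forall>X\<in>B. \<forall>Y\<in>B. \<forall>\<alpha>\<in>label_words E L.
        rel_range E L X \<alpha> \<inter> rel_range E L Y \<alpha> = rel_range E L (X \<inter> Y) \<alpha>)"

definition arcs_from :: "('v, 'e) pre_digraph \<Rightarrow> 'v set \<Rightarrow> 'e set" where
  "arcs_from E A = {e \<in> arcs E. tail E e \<in> A}"

definition arcs_into :: "('v, 'e) pre_digraph \<Rightarrow> 'v set \<Rightarrow> 'e set" where
  "arcs_into E A = {e \<in> arcs E. head E e \<in> A}"

definition set_finite :: "('v, 'e) pre_digraph \<Rightarrow> ('e \<Rightarrow> 'l) \<Rightarrow> 'v set set \<Rightarrow> bool" where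
  "set_finite E L B \<longleftrightarrow> (\<forall>X\<in>B. finite (L ` arcs_from E X))"

definition receiver_set_finite :: "('v, 'e) pre_digraph \<Rightarrow> ('e \<Rightarrow> 'l) \<Rightarrow> 'v set set \<Rightarrow> bool" where
  "receiver_set_finite E L B \<longleftrightarrow> (\<forall>X\<in>B. finite (L ` arcs_into E X))"

text \<open>\<open>\<E>\<^sup>0\<^sup>,\<^sup>-\<close> and its counterpart closed under relative complements.\<close>

definition E0minus :: "('v, 'e) pre_digraph \<Rightarrow> ('e \<Rightarrow> 'l) \<Rightarrow> 'v set set" where
  "E0minus E L = \<Inter> {B. accommodating E L B}"

definition Ebar :: "('v, 'e) pre_digraph \<Rightarrow> ('e \<Rightarrow> 'l) \<Rightarrow> 'v set set" where
  "Ebar E L = \<Inter> {B. accommodating E L B \<and> (\<forall>X\<in>B. \<forall>Y\<in>B. X - Y \<in> B)}"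

text \<open>The two intersections belong to the families they are intersections of, hence are their
  least elements.\<close>

lemma (in wf_digraph) accommodating_Pow: "accommodating G L (Pow (verts G))"
  unfolding accommodating_def word_range_def rel_range_def
  using awalk_last_in_verts by blast

lemma (in wf_digraph) accommodating_E0minus: "accommodating G L (E0minus G L)"
proof -
  have "E0minus G L \<subseteq> Pow (verts G)"
    unfolding E0minus_def using accommodating_Pow by blast
  then show ?thesis
    unfolding accommodating_def[of G L "E0minus G L"] unfolding E0minus_def accommodating_def by auto
qed

lemma (in wf_digraph) accommodating_Ebar:
  "accommodating G L (Ebar G L)"
  "X \<in> Ebar G L \<Longrightarrow> Y \<in> Ebar G L \<Longrightarrow> X - Y \<in> Ebar G L"
proof -
  have "Ebar G L \<subseteq> Pow (verts G)"
    unfolding Ebar_def using accommodating_Pow by blast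
  then show "accommodating G L (Ebar G L)"
    unfolding accommodating_def[of G L "Ebar G L"] unfolding Ebar_def accommodating_def by auto
  show "X \<in> Ebar G L \<Longrightarrow> Y \<in> Ebar G L \<Longrightarrow> X - Y \<in> Ebar G L"
    unfolding Ebar_def by blast
qed


section \<open>C*-algebras\<close>

text \<open>
  C*-algebras need not be unital: the field \<^const>\<open>one\<close>, which is inherited from the library's ring
  record, is unconstrained and never used.
\<close>

record 'c star_algebra = "(complex, 'c) module" +
  star :: "'c \<Rightarrow> 'c"
  cnorm :: "'c \<Rightarrow> real"

locale cstar_algebra = abelian_group C for C :: "'c star_algebra" (structure) +
  assumes smult_closed: "x \<in> carrier C \<Longrightarrow> c \<odot> x \<in> carrier C"
    and smult_l_distr: "x \<in> carrier C \<Longrightarrow> (c + d) \<odot> x = c \<odot> x \<oplus> d \<odot> x"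
    and smult_r_distr: "x \<in> carrier C \<Longrightarrow> y \<in> carrier C \<Longrightarrow> c \<odot> (x \<oplus> y) = c \<odot> x \<oplus> c \<odot> y"
    and smult_assoc: "x \<in> carrier C \<Longrightarrow> (c * d) \<odot> x = c \<odot> (d \<odot> x)"
    and smult_one: "x \<in> carrier C \<Longrightarrow> 1 \<odot> x = x"
    and mult_closed: "x \<in> carrier C \<Longrightarrow> y \<in> carrier C \<Longrightarrow> x \<otimes> y \<in> carrier C"
    and mult_assoc: "x \<in> carrier C \<Longrightarrow> y \<in> carrier C \<Longrightarrow> z \<in> carrier C \<Longrightarrow>
      (x \<otimes> y) \<otimes> z = x \<otimes> (y \<otimes> z)"
    and mult_l_distr: "x \<in> carrier C \<Longrightarrow> y \<in> carrier C \<Longrightarrow> z \<in> carrier C \<Longrightarrow>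
      (x \<oplus> y) \<otimes> z = x \<otimes> z \<oplus> y \<otimes> z"
    and mult_r_distr: "x \<in> carrier C \<Longrightarrow> y \<in> carrier C \<Longrightarrow> z \<in> carrier C \<Longrightarrow>
      z \<otimes> (x \<oplus> y) = z \<otimes> x \<oplus> z \<otimes> y"
    and smult_mult_left: "x \<in> carrier C \<Longrightarrow> y \<in> carrier C \<Longrightarrow> (c \<odot> x) \<otimes> y = c \<odot> (x \<otimes> y)"
    and smult_mult_right: "x \<in> carrier C \<Longrightarrow> y \<in> carrier C \<Longrightarrow> x \<otimes> (c \<odot> y) = c \<odot> (x \<otimes> y)"
    and star_closed: "x \<in> carrier C \<Longrightarrow> star C x \<in> carrier C"
    and star_star: "x \<in> carrier C \<Longrightarrow> star C (star C x) = x"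
    and star_add: "x \<in> carrier C \<Longrightarrow> y \<in> carrier C \<Longrightarrow> star C (x \<oplus> y) = star C x \<oplus> star C y"
    and star_smult: "x \<in> carrier C \<Longrightarrow> star C (c \<odot> x) = cnj c \<odot> star C x"
    and star_mult: "x \<in> carrier C \<Longrightarrow> y \<in> carrier C \<Longrightarrow> star C (x \<otimes> y) = star C y \<otimes> star C x"
    and cnorm_nonneg: "x \<in> carrier C \<Longrightarrow> 0 \<le> cnorm C x"
    and cnorm_eq_zero: "x \<in> carrier C \<Longrightarrow> cnorm C x = 0 \<longleftrightarrow> x = \<zero>"
    and cnorm_smult: "x \<in> carrier C \<Longrightarrow> cnorm C (c \<odot> x) = cmod c * cnorm C x"
    and cnorm_triangle: "x \<in> carrier C \<Longrightarrow> y \<in> carrier C \<Longrightarrow>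
      cnorm C (x \<oplus> y) \<le> cnorm C x + cnorm C y"
    and cnorm_mult: "x \<in> carrier C \<Longrightarrow> y \<in> carrier C \<Longrightarrow>
      cnorm C (x \<otimes> y) \<le> cnorm C x * cnorm C y"
    and cstar_identity: "x \<in> carrier C \<Longrightarrow> cnorm C (star C x \<otimes> x) = (cnorm C x)\<^sup>2"
    and complete: "range X \<subseteq> carrier C \<Longrightarrow>
      (\<forall>\<epsilon>>0. \<exists>N. \<forall>m\<ge>N. \<forall>n\<ge>N. cnorm C (X m \<ominus> X n) < \<epsilon>) \<Longrightarrow>
      \<exists>x\<in>carrier C. (\<lambda>n. cnorm C (X n \<ominus> x)) \<longlonglongrightarrow> 0"

definition star_hom :: "'c star_algebra \<Rightarrow> 'd star_algebra \<Rightarrow> ('c \<Rightarrow> 'd) \<Rightarrow> bool" where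
  "star_hom C D \<phi> \<longleftrightarrow>
     \<phi> ` carrier C \<subseteq> carrier D \<and>
     (\<forall>x\<in>carrier C. \<forall>y\<in>carrier C. \<phi> (x \<oplus>\<^bsub>C\<^esub> y) = \<phi> x \<oplus>\<^bsub>D\<^esub> \<phi> y) \<and>
     (\<forall>c. \<forall>x\<in>carrier C. \<phi> (c \<odot>\<^bsub>C\<^esub> x) = c \<odot>\<^bsub>D\<^esub> \<phi> x) \<and>
     (\<forall>x\<in>carrier C. \<forall>y\<in>carrier C. \<phi> (x \<otimes>\<^bsub>C\<^esub> y) = \<phi> x \<otimes>\<^bsub>D\<^esub> \<phi> y) \<and>
     (\<forall>x\<in>carrier C. \<phi> (star C x) = star D (\<phi> x))"

text \<open>Star-homomorphisms between C*-algebras are automatically contractive, and bijective ones are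
  automatically isometric, so no condition on the norms is imposed.\<close>

definition cstar_isomorphic :: "'c star_algebra \<Rightarrow> 'd star_algebra \<Rightarrow> bool" where
  "cstar_isomorphic C D \<longleftrightarrow> (\<exists>\<phi>. star_hom C D \<phi> \<and> bij_betw \<phi> (carrier C) (carrier D))"

definition closed_star_subalgebra :: "'c star_algebra \<Rightarrow> 'c set \<Rightarrow> bool" where
  "closed_star_subalgebra C S \<longleftrightarrow>
     S \<subseteq> carrier C \<and>
     \<zero>\<^bsub>C\<^esub> \<in> S \<and>
     (\<forall>x\<in>S. \<forall>y\<in>S. x \<oplus>\<^bsub>C\<^esub> y \<in> S) \<and>
     (\<forall>c. \<forall>x\<in>S. c \<odot>\<^bsub>C\<^esub> x \<in> S) \<and>
     (\<forall>x\<in>S. \<forall>y\<in>S. x \<otimes>\<^bsub>C\<^esub> y \<in> S) \<and>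
     (\<forall>x\<in>S. star C x \<in> S) \<and>
     (\<forall>X x. range X \<subseteq> S \<and> x \<in> carrier C \<and> (\<lambda>n. cnorm C (X n \<ominus>\<^bsub>C\<^esub> x)) \<longlonglongrightarrow> 0
        \<longrightarrow> x \<in> S)"

definition cstar_generated :: "'c star_algebra \<Rightarrow> 'c set \<Rightarrow> 'c set" where
  "cstar_generated C G = \<Inter> {S. closed_star_subalgebra C S \<and> G \<subseteq> S}"

definition is_projection :: "'c star_algebra \<Rightarrow> 'c \<Rightarrow> bool" where
  "is_projection C x \<longleftrightarrow> x \<in> carrier C \<and> star C x = x \<and> x \<otimes>\<^bsub>C\<^esub> x = x"

definition is_partial_isometry :: "'c star_algebra \<Rightarrow> 'c \<Rightarrow> bool" where
  "is_partial_isometry C x \<longleftrightarrow> x \<in> carrier C \<and> x \<otimes>\<^bsub>C\<^esub> star C x \<otimes>\<^bsub>C\<^esub> x = x"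


section \<open>The C*-algebra of a labelled space\<close>

definition representation ::
    "('v, 'e) pre_digraph \<Rightarrow> ('e \<Rightarrow> 'l) \<Rightarrow> 'l set \<Rightarrow> 'v set set \<Rightarrow>
     'c star_algebra \<Rightarrow> ('v set \<Rightarrow> 'c) \<Rightarrow> ('l \<Rightarrow> 'c) \<Rightarrow> bool" where
  "representation E L Al B C p s \<longleftrightarrow>
     (\<forall>X\<in>B. is_projection C (p X)) \<and>
     (\<forall>a\<in>Al. is_partial_isometry C (s a)) \<and>
     p {} = \<zero>\<^bsub>C\<^esub> \<and>
     (\<forall>X\<in>B. \<forall>Y\<in>B. p X \<otimes>\<^bsub>C\<^esub> p Y = p (X \<inter> Y)) \<and>
     (\<forall>X\<in>B. \<forall>Y\<in>B. p (X \<union> Y) = p X \<oplus>\<^bsub>C\<^esub> p Y \<ominus>\<^bsub>C\<^esub> p (X \<inter> Y)) \<and>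
     (\<forall>X\<in>B. \<forall>a\<in>Al. p X \<otimes>\<^bsub>C\<^esub> s a = s a \<otimes>\<^bsub>C\<^esub> p (rel_range E L X [a])) \<and>
     (\<forall>a\<in>Al. star C (s a) \<otimes>\<^bsub>C\<^esub> s a = p (word_range E L [a])) \<and>
     (\<forall>a\<in>Al. \<forall>b\<in>Al. a \<noteq> b \<longrightarrow> star C (s a) \<otimes>\<^bsub>C\<^esub> s b = \<zero>\<^bsub>C\<^esub>) \<and>
     (\<forall>X\<in>B. finite (L ` arcs_from E X) \<and> L ` arcs_from E X \<noteq> {} \<longrightarrow>
        p X = (\<Oplus>\<^bsub>C\<^esub>a\<in>L ` arcs_from E X. s a \<otimes>\<^bsub>C\<^esub> p (rel_range E L X [a]) \<otimes>\<^bsub>C\<^esub> star C (s a)))"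

text \<open>
  \<open>C\<close> is (a copy of) \<open>C\<^sup>*(E, \<L>, B)\<close>: it is generated by a representation through which every
  representation in a C*-algebra factors. A formula cannot quantify over types, so the test
  algebras \<open>D\<close> range over all C*-algebras whose elements are taken from the type \<open>'c\<close> of elements
  of \<open>C\<close>. When \<open>B\<close> and \<open>Al\<close> are countable, this is no restriction as soon as \<open>'c\<close> has at least the
  cardinality of the continuum: a representation can be corestricted to the C*-algebra that it
  generates, which is separable, so has at most continuum many elements and can be copied onto a
  subset of \<open>'c\<close>. The families \<open>\<E>\<^sup>0\<^sup>,\<^sup>-\<close> and \<^const>\<open>Ebar\<close> of a labelled graph are countable.
\<close>

definition is_labelled_space_cstar ::
    "('v, 'e) pre_digraph \<Rightarrow> ('e \<Rightarrow> 'l) \<Rightarrow> 'l set \<Rightarrow> 'v set set \<Rightarrow> 'c star_algebra \<Rightarrow> bool" where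
  "is_labelled_space_cstar E L Al B C \<longleftrightarrow>
     cstar_algebra C \<and>
     (\<exists>p s. representation E L Al B C p s \<and>
        cstar_generated C (p ` B \<union> s ` Al) = carrier C \<and>
        (\<forall>(D :: 'c star_algebra) q t.
           cstar_algebra D \<and> representation E L Al B D q t \<longrightarrow>
           (\<exists>\<phi>. star_hom C D \<phi> \<and> (\<forall>X\<in>B. \<phi> (p X) = q X) \<and> (\<forall>a\<in>Al. \<phi> (s a) = t a))))"

end

theory Submission
  imports Defs "HOL-Analysis.Topology_Euclidean_Space"
begin

text \<open>
  The two universal objects coincide because a representation of the smaller labelled space is
  the same thing as a representation of the larger one. If \<open>(p, s)\<close> represents \<open>\<E>\<^sup>0\<^sup>,\<^sup>-\<close>, then a
  difference of sets must be sent to \<open>p A - p A p B\<close>. Since \<open>p\<close> turns intersections into products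
  and unions into joins of commuting projections, this prescription is consistent on the whole ring
  of sets generated by \<open>\<E>\<^sup>0\<^sup>,\<^sup>-\<close> (\<open>extends_to_unique\<close>). Weak left resolution of \<^const>\<open>Ebar\<close> makes relative
  ranges commute with differences, so the ring is closed under relative ranges and is therefore all of
  \<^const>\<open>Ebar\<close>, and the covariance relation for differences follows from that for the two sets. The
  summation relation for \<open>Z\<close> in \<^const>\<open>Ebar\<close> results from multiplying the one for some larger
  \<open>X\<close> in \<open>\<E>\<^sup>0\<^sup>,\<^sup>-\<close>, which is available by set-finiteness, with the projection of \<open>Z\<close>. Altogether
  \<open>(p, s)\<close> extends to a representation of \<^const>\<open>Ebar\<close> (\<open>representation_pbar\<close>); in the other
  direction representations restrict.

  The universal properties now give star-homomorphisms in both directions whose composites fix the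
  generators. The extended projections are polynomials in the given ones, so a homomorphism that
  is right on \<open>\<E>\<^sup>0\<^sup>,\<^sup>-\<close> is right on \<^const>\<open>Ebar\<close> (\<open>star_hom_extends_to\<close>).

  To conclude that the composites are identities one needs that star-homomorphisms are continuous
  (\<open>star_hom_contractive\<close>). As homomorphisms preserve quasi-invertibility, this reduces to the fact
  that the spectral radius of a self-adjoint element \<open>k\<close> is its norm
  (\<open>selfadjoint_not_quasi_invertible\<close>). That fact is proved without function theory, by averaging
  the resolvent over roots of unity of order \<open>2\<^sup>n\<close>, which yields the resolvent of \<open>k\<close> to the power
  \<open>2\<^sup>n\<close>. The algebras may lack a unit, so the resolvent is expressed through quasi-inverses.
\<close>

section \<open>Arithmetic and limits in a C*-algebra\<close>

context cstar_algebra
begin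

declare smult_closed [simp] mult_closed [simp] star_closed [simp] star_star [simp]
  smult_one [simp]

lemma smult_zero_left [simp]: "x \<in> carrier C \<Longrightarrow> 0 \<odot> x = \<zero>"
  using smult_l_distr[of x 0 0] add.r_cancel_one' [of "0 \<odot> x" "0 \<odot> x"] by simp

lemma l_null [simp]: "x \<in> carrier C \<Longrightarrow> \<zero> \<otimes> x = \<zero>"
  using smult_mult_left[of \<zero> x 0] by simp

lemma r_null [simp]: "x \<in> carrier C \<Longrightarrow> x \<otimes> \<zero> = \<zero>"
  using smult_mult_right[of x \<zero> 0] by simp

lemma minus_eq_smult: "x \<in> carrier C \<Longrightarrow> \<ominus> x = (-1) \<odot> x"
  using smult_l_distr[of x 1 "-1"] by (simp add: minus_equality a_comm)

lemma smult_minus: "x \<in> carrier C \<Longrightarrow> c \<odot> (\<ominus> x) = \<ominus> (c \<odot> x)"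
  by (simp add: minus_eq_smult smult_assoc[symmetric])

lemma l_minus: "x \<in> carrier C \<Longrightarrow> y \<in> carrier C \<Longrightarrow> (\<ominus> x) \<otimes> y = \<ominus> (x \<otimes> y)"
  by (simp add: minus_eq_smult smult_mult_left)

lemma r_minus: "x \<in> carrier C \<Longrightarrow> y \<in> carrier C \<Longrightarrow> x \<otimes> (\<ominus> y) = \<ominus> (x \<otimes> y)"
  by (simp add: minus_eq_smult smult_mult_right)

lemma star_minus: "x \<in> carrier C \<Longrightarrow> star C (\<ominus> x) = \<ominus> (star C x)"
  by (simp add: minus_eq_smult star_smult)

lemma cnorm_zero [simp]: "cnorm C \<zero> = 0"
  using cnorm_eq_zero by blast

lemma minus_zero [simp]: "\<ominus> \<zero> = \<zero>"
  by (rule minus_equality) simp_all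

lemma cnorm_minus [simp]: "x \<in> carrier C \<Longrightarrow> cnorm C (\<ominus> x) = cnorm C x"
  by (simp add: minus_eq_smult cnorm_smult)

lemmas alg_simps = minus_eq minus_add minus_minus a_assoc a_comm a_lcomm r_neg l_neg r_neg1 r_neg2
  mult_l_distr mult_r_distr l_minus r_minus mult_assoc smult_minus
  smult_r_distr smult_mult_left smult_mult_right

lemma add_eq_imp_eq_diff:
  "a \<in> carrier C \<Longrightarrow> b \<in> carrier C \<Longrightarrow> c = a \<oplus> b \<Longrightarrow> b = c \<ominus> a"
  by (simp add: minus_eq a_comm[of a b] a_assoc r_neg)

lemma cnorm_diff_triangle:
  assumes "x \<in> carrier C" "y \<in> carrier C" "z \<in> carrier C"
  shows "cnorm C (x \<ominus> z) \<le> cnorm C (x \<ominus> y) + cnorm C (y \<ominus> z)"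
proof -
  have "x \<ominus> z = (x \<ominus> y) \<oplus> (y \<ominus> z)"
    using assms by (simp add: alg_simps)
  then show ?thesis using cnorm_triangle[of "x \<ominus> y" "y \<ominus> z"] assms by simp
qed

lemma cnorm_diff_commute:
  assumes "x \<in> carrier C" "y \<in> carrier C"
  shows "cnorm C (x \<ominus> y) = cnorm C (y \<ominus> x)"
proof -
  have "x \<ominus> y = \<ominus> (y \<ominus> x)" using assms by (simp add: alg_simps)
  then show ?thesis using assms by simp
qed

lemma diff_eq_zeroD: "x \<in> carrier C \<Longrightarrow> y \<in> carrier C \<Longrightarrow> x \<ominus> y = \<zero> \<Longrightarrow> x = y"
  using minus_equality[of x "\<ominus> y"] by (simp add: minus_eq)

lemma cnorm_le_diff:
  assumes "x \<in> carrier C" "y \<in> carrier C"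
  shows "cnorm C x \<le> cnorm C (x \<ominus> y) + cnorm C y"
  using cnorm_diff_triangle[of x y \<zero>] assms by (simp add: minus_eq)

lemma limit_unique:
  assumes "\<And>n. X n \<in> carrier C" "x \<in> carrier C" "y \<in> carrier C"
    and "(\<lambda>n. cnorm C (X n \<ominus> x)) \<longlonglongrightarrow> 0" "(\<lambda>n. cnorm C (X n \<ominus> y)) \<longlonglongrightarrow> 0"
  shows "x = y"
proof -
  have lim: "(\<lambda>n. cnorm C (X n \<ominus> x) + cnorm C (X n \<ominus> y)) \<longlonglongrightarrow> 0"
    using tendsto_add[OF assms(4,5)] by simp
  have "cnorm C (x \<ominus> y) \<le> cnorm C (X n \<ominus> x) + cnorm C (X n \<ominus> y)" for n
    using cnorm_diff_triangle[of x "X n" y] cnorm_diff_commute[of x "X n"] assms by simp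
  then have "cnorm C (x \<ominus> y) \<le> 0"
    using LIMSEQ_le_const[OF lim] by blast
  then have "cnorm C (x \<ominus> y) = 0"
    using cnorm_nonneg[of "x \<ominus> y"] assms by simp
  then show ?thesis
    using cnorm_eq_zero[of "x \<ominus> y"] diff_eq_zeroD[of x y] assms by blast
qed

end

section \<open>Quasi-inverses and the spectral radius\<close>

context cstar_algebra
begin

text \<open>In a unitization, \<open>quasi_inverse x y\<close> says that \<open>1 + y\<close> is a two-sided inverse of \<open>1 - x\<close>.\<close>

definition quasi_inverse :: "'c \<Rightarrow> 'c \<Rightarrow> bool" where
  "quasi_inverse x y \<longleftrightarrow>
     x \<in> carrier C \<and> y \<in> carrier C \<and> y = x \<oplus> x \<otimes> y \<and> y = x \<oplus> y \<otimes> x"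

lemma quasi_inverse_norm_bound:
  assumes "quasi_inverse x y" "cnorm C x < 1"
  shows "cnorm C y \<le> cnorm C x / (1 - cnorm C x)"
proof -
  have c: "x \<in> carrier C" "y \<in> carrier C" "y = x \<oplus> x \<otimes> y"
    using assms by (auto simp: quasi_inverse_def)
  have "cnorm C y \<le> cnorm C x + cnorm C x * cnorm C y"
    using cnorm_triangle[of x "x \<otimes> y"] cnorm_mult[of x y] c by simp
  then show ?thesis using assms(2) by (simp add: field_simps)
qed

text \<open>
  The quasi-inverse is the sum of the powers of \<open>x\<close>. Its partial sums arise by iterating the
  contraction \<open>y \<mapsto> x + x y\<close>; they commute with \<open>x\<close>, so that one limit satisfies both equations.
\<close>

lemma quasi_inverse_exists:
  assumes x: "x \<in> carrier C" and small: "cnorm C x < 1"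
  shows "\<exists>y. quasi_inverse x y"
proof -
  define r where "r = cnorm C x"
  have r: "0 \<le> r" "r < 1" using assms cnorm_nonneg by (auto simp: r_def)
  define Y where "Y = rec_nat x (\<lambda>_ y. x \<oplus> x \<otimes> y)"
  have Y0: "Y 0 = x" and YS: "Y (Suc n) = x \<oplus> x \<otimes> Y n" for n
    by (simp_all add: Y_def)
  have Yc [simp]: "Y n \<in> carrier C" for n
    by (induction n) (simp_all add: Y0 YS x)
  have comm: "x \<otimes> Y n = Y n \<otimes> x" for n
    by (induction n) (simp_all add: Y0 YS x mult_l_distr mult_r_distr mult_assoc[symmetric])
  have Yb: "cnorm C (Y n) \<le> r / (1 - r)" for n
  proof (induction n)
    case 0
    have "r * (1 - r) \<le> r" using r by (simp add: mult_left_le)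
    then show ?case using r by (simp add: Y0 r_def[symmetric] field_simps)
  next
    case (Suc n)
    have "cnorm C (Y (Suc n)) \<le> r + r * cnorm C (Y n)"
      using cnorm_triangle[of x "x \<otimes> Y n"] cnorm_mult[of x "Y n"] x by (simp add: YS r_def)
    also have "\<dots> \<le> r + r * (r / (1 - r))"
      using Suc r by (intro add_left_mono mult_left_mono)
    also have "\<dots> = r / (1 - r)" using r by (simp add: field_simps)
    finally show ?case .
  qed
  have step: "cnorm C (Y (n + k) \<ominus> Y n) \<le> r ^ n * (2 * r / (1 - r))" for n k
  proof (induction n)
    case 0
    have "cnorm C (Y k \<ominus> Y 0) \<le> cnorm C (Y k) + cnorm C (Y 0)"
      using cnorm_triangle[of "Y k" "\<ominus> Y 0"] by (simp add: minus_eq)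
    then show ?case using Yb[of k] Yb[of 0] by simp
  next
    case (Suc n)
    have "Y (Suc n + k) \<ominus> Y (Suc n) = x \<otimes> (Y (n + k) \<ominus> Y n)"
      using x by (simp add: YS alg_simps)
    then have "cnorm C (Y (Suc n + k) \<ominus> Y (Suc n)) \<le> r * cnorm C (Y (n + k) \<ominus> Y n)"
      using cnorm_mult[of x "Y (n + k) \<ominus> Y n"] x by (simp add: r_def)
    also have "\<dots> \<le> r * (r ^ n * (2 * r / (1 - r)))"
      using Suc r by (intro mult_left_mono)
    finally show ?case by (simp add: mult.assoc)
  qed
  have step': "cnorm C (Y m \<ominus> Y n) \<le> r ^ N * (2 * r / (1 - r)) * 2" if "N \<le> m" "N \<le> n" for N m n
  proof -
    have "cnorm C (Y m \<ominus> Y n) \<le> cnorm C (Y m \<ominus> Y N) + cnorm C (Y n \<ominus> Y N)"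
      using cnorm_diff_triangle[of "Y m" "Y N" "Y n"] cnorm_diff_commute[of "Y N" "Y n"] by simp
    then show ?thesis using step[of N "m - N"] step[of N "n - N"] that by simp
  qed
  have lim: "(\<lambda>N. r ^ N * (2 * r / (1 - r)) * 2) \<longlonglongrightarrow> 0"
    using r by (intro tendsto_mult_left_zero LIMSEQ_power_zero) auto
  have cauchy: "\<forall>\<epsilon>>0. \<exists>N. \<forall>m\<ge>N. \<forall>n\<ge>N. cnorm C (Y m \<ominus> Y n) < \<epsilon>"
  proof (intro allI impI)
    fix \<epsilon> :: real assume \<epsilon>: "0 < \<epsilon>"
    obtain N where N: "r ^ N * (2 * r / (1 - r)) * 2 < \<epsilon>"
      using order_tendstoD(2)[OF lim \<epsilon>] unfolding eventually_sequentially by blast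
    show "\<exists>N. \<forall>m\<ge>N. \<forall>n\<ge>N. cnorm C (Y m \<ominus> Y n) < \<epsilon>"
    proof (intro exI[of _ N] allI impI)
      fix m n assume "N \<le> m" "N \<le> n"
      from le_less_trans[OF step'[OF this] N] show "cnorm C (Y m \<ominus> Y n) < \<epsilon>" .
    qed
  qed
  have "range Y \<subseteq> carrier C" using Yc by blast
  from complete[OF this cauchy]
  obtain y where y: "y \<in> carrier C" "(\<lambda>n. cnorm C (Y n \<ominus> y)) \<longlonglongrightarrow> 0" by blast
  have lim_eq: "y = x \<oplus> w" if w: "w \<in> carrier C"
    and le: "\<And>n. cnorm C (x \<otimes> Y n \<ominus> w) \<le> r * cnorm C (Y n \<ominus> y)" for w
  proof (rule limit_unique[of "\<lambda>n. Y (Suc n)"])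
    have "Y (Suc n) \<ominus> (x \<oplus> w) = x \<otimes> Y n \<ominus> w" for n
      using x w by (simp add: YS alg_simps)
    then have upper: "cnorm C (Y (Suc n) \<ominus> (x \<oplus> w)) \<le> r * cnorm C (Y n \<ominus> y)" for n
      using le by simp
    have lower: "0 \<le> cnorm C (Y (Suc n) \<ominus> (x \<oplus> w))" for n
      using x w by (simp add: cnorm_nonneg)
    show "(\<lambda>n. cnorm C (Y (Suc n) \<ominus> (x \<oplus> w))) \<longlonglongrightarrow> 0"
      by (rule tendsto_sandwich[OF always_eventually always_eventually tendsto_const
            tendsto_mult_right_zero[OF y(2)]]) (use lower upper in blast)+
    show "(\<lambda>n. cnorm C (Y (Suc n) \<ominus> y)) \<longlonglongrightarrow> 0"
      using y(2) by (rule LIMSEQ_Suc)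
  qed (use x w y in auto)
  have "y = x \<oplus> x \<otimes> y"
  proof (rule lim_eq)
    fix n
    have "x \<otimes> Y n \<ominus> x \<otimes> y = x \<otimes> (Y n \<ominus> y)" using x y by (simp add: alg_simps)
    then show "cnorm C (x \<otimes> Y n \<ominus> x \<otimes> y) \<le> r * cnorm C (Y n \<ominus> y)"
      using cnorm_mult[of x "Y n \<ominus> y"] x y by (simp add: r_def)
  qed (use x y in simp)
  moreover have "y = x \<oplus> y \<otimes> x"
  proof (rule lim_eq)
    fix n
    have "x \<otimes> Y n \<ominus> y \<otimes> x = (Y n \<ominus> y) \<otimes> x" using x y by (simp add: comm alg_simps)
    then show "cnorm C (x \<otimes> Y n \<ominus> y \<otimes> x) \<le> r * cnorm C (Y n \<ominus> y)"
      using cnorm_mult[of "Y n \<ominus> y" x] x y by (simp add: r_def mult.commute)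
  qed (use x y in simp)
  ultimately show ?thesis using x y by (auto simp: quasi_inverse_def)
qed

text \<open>
  With \<open>1 + y\<close> and \<open>1 + z\<close> inverse to \<open>1 - \<kappa> k\<close> and \<open>1 - \<mu> k\<close>, the right-hand side is
  \<open>(1 + y) ((1 - \<mu> k) - (1 - \<kappa> k)) (1 + z)\<close>, multiplied out so that no unit occurs.
\<close>

lemma resolvent_identity:
  assumes k: "k \<in> carrier C"
    and y: "quasi_inverse (\<kappa> \<odot> k) y" and z: "quasi_inverse (\<mu> \<odot> k) z"
  shows "y \<ominus> z = (\<kappa> - \<mu>) \<odot> (k \<oplus> y \<otimes> k \<oplus> (k \<otimes> z \<oplus> y \<otimes> k \<otimes> z))"
proof -
  define P where "P = k \<oplus> y \<otimes> k \<oplus> (k \<otimes> z \<oplus> y \<otimes> k \<otimes> z)"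
  have c: "y \<in> carrier C" "z \<in> carrier C" "P \<in> carrier C"
    using y z k by (auto simp: quasi_inverse_def P_def)
  have yk: "y = \<kappa> \<odot> (k \<oplus> y \<otimes> k)" and zk: "z = \<mu> \<odot> (k \<oplus> k \<otimes> z)"
    using y z k c by (simp_all add: quasi_inverse_def smult_r_distr smult_mult_left smult_mult_right)
  have "P = (k \<oplus> y \<otimes> k) \<oplus> (k \<oplus> y \<otimes> k) \<otimes> z"
    using k c by (simp add: P_def mult_l_distr mult_assoc)
  then have 1: "\<kappa> \<odot> P = y \<oplus> y \<otimes> z"
    using k c yk by (metis a_closed mult_closed smult_mult_left smult_r_distr)
  have "P = (k \<oplus> k \<otimes> z) \<oplus> y \<otimes> (k \<oplus> k \<otimes> z)"
    using k c by (simp add: P_def mult_r_distr mult_assoc a_ac)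
  then have 2: "\<mu> \<odot> P = z \<oplus> y \<otimes> z"
    using k c zk by (metis a_closed mult_closed smult_mult_right smult_r_distr)
  have "(\<kappa> - \<mu>) \<odot> P = \<kappa> \<odot> P \<ominus> \<mu> \<odot> P"
    using c smult_l_distr[of P \<kappa> "- \<mu>"]
    by (simp add: minus_eq minus_eq_smult smult_assoc[symmetric])
  also have "\<dots> = y \<ominus> z"
    unfolding 1 2 using c by (simp add: alg_simps)
  finally show ?thesis by (simp add: P_def)
qed

lemma resolvent_lipschitz:
  assumes k: "k \<in> carrier C" "cnorm C k = 1"
    and y: "quasi_inverse (\<kappa> \<odot> k) y" and z: "quasi_inverse (\<mu> \<odot> k) z"
  shows "cnorm C (y \<ominus> z) \<le> cmod (\<kappa> - \<mu>) * (1 + cnorm C y) * (1 + cnorm C z)"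
proof -
  have c: "y \<in> carrier C" "z \<in> carrier C"
    using y z by (auto simp: quasi_inverse_def)
  have yk: "cnorm C (y \<otimes> k) \<le> cnorm C y" and kz: "cnorm C (k \<otimes> z) \<le> cnorm C z"
    using cnorm_mult[of y k] cnorm_mult[of k z] k c by simp_all
  have "cnorm C (y \<otimes> k \<otimes> z) \<le> cnorm C (y \<otimes> k) * cnorm C z"
    using cnorm_mult[of "y \<otimes> k" z] k c by simp
  also have "\<dots> \<le> cnorm C y * cnorm C z"
    using yk c cnorm_nonneg by (intro mult_right_mono) auto
  finally have ykz: "cnorm C (y \<otimes> k \<otimes> z) \<le> cnorm C y * cnorm C z" .
  have "cnorm C (k \<oplus> y \<otimes> k \<oplus> (k \<otimes> z \<oplus> y \<otimes> k \<otimes> z)) \<le> (1 + cnorm C y) * (1 + cnorm C z)"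
    using cnorm_triangle[of "k \<oplus> y \<otimes> k" "k \<otimes> z \<oplus> y \<otimes> k \<otimes> z"] cnorm_triangle[of k "y \<otimes> k"]
      cnorm_triangle[of "k \<otimes> z" "y \<otimes> k \<otimes> z"] k c yk kz ykz
    by (simp add: algebra_simps)
  then have "cmod (\<kappa> - \<mu>) * cnorm C (k \<oplus> y \<otimes> k \<oplus> (k \<otimes> z \<oplus> y \<otimes> k \<otimes> z))
      \<le> cmod (\<kappa> - \<mu>) * ((1 + cnorm C y) * (1 + cnorm C z))"
    by (intro mult_left_mono) auto
  then show ?thesis
    using k c by (simp add: resolvent_identity[OF k(1) y z] cnorm_smult mult.assoc)
qed

lemma half_double:
  assumes "u \<in> carrier C"
  shows "(1/2) \<odot> (u \<oplus> u) = u"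
proof -
  have "(1/2) \<odot> (u \<oplus> u) = (1/2 + 1/2) \<odot> u"
    unfolding smult_l_distr[OF assms] by (simp add: smult_r_distr assms)
  then show ?thesis using assms by simp
qed

text \<open>
  The partial fraction \<open>1 / (1 - x\<^sup>2) = (1 / (1 - x) + 1 / (1 + x)) / 2\<close>. Iterated, it expresses the
  resolvent of a power of order \<open>2\<^sup>n\<close> as an average of resolvents.
\<close>

lemma quasi_inverse_square:
  assumes y: "quasi_inverse x y" and z: "quasi_inverse (\<ominus> x) z"
  shows "quasi_inverse (x \<otimes> x) ((1/2) \<odot> (y \<oplus> z))"
proof -
  have c: "x \<in> carrier C" "y \<in> carrier C" "z \<in> carrier C"
    using y z a_inv_closed minus_minus by (auto simp: quasi_inverse_def)
  have ye: "y = x \<oplus> x \<otimes> y" "y = x \<oplus> y \<otimes> x"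
    and ze: "z = \<ominus> x \<oplus> (\<ominus> x) \<otimes> z" "z = \<ominus> x \<oplus> z \<otimes> (\<ominus> x)"
    using y z unfolding quasi_inverse_def by blast+
  have y1: "x \<otimes> y = y \<ominus> x" and y2: "y \<otimes> x = y \<ominus> x"
    using add_eq_imp_eq_diff[OF _ _ ye(1)] add_eq_imp_eq_diff[OF _ _ ye(2)] c by simp_all
  have "(\<ominus> x) \<otimes> z = z \<ominus> \<ominus> x" "z \<otimes> (\<ominus> x) = z \<ominus> \<ominus> x"
    using add_eq_imp_eq_diff[OF _ _ ze(1)] add_eq_imp_eq_diff[OF _ _ ze(2)] c a_inv_closed mult_closed by metis+
  then have "\<ominus> (x \<otimes> z) = z \<oplus> x" "\<ominus> (z \<otimes> x) = z \<oplus> x"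
    by (simp_all only: l_minus r_minus c minus_eq minus_minus)
  then have z1: "x \<otimes> z = \<ominus> (z \<oplus> x)" and z2: "z \<otimes> x = \<ominus> (z \<oplus> x)"
    by (metis minus_minus mult_closed c)+
  have cancel: "(u \<ominus> x) \<oplus> (v \<oplus> x) = u \<oplus> v"
    if "u \<in> carrier C" "v \<in> carrier C" for u v
    using that c(1) by (simp add: minus_eq a_ac r_neg r_neg2)
  have double: "x \<otimes> (x \<otimes> (y \<oplus> z)) = (y \<oplus> z) \<ominus> (x \<otimes> x \<oplus> x \<otimes> x)"
    "((y \<oplus> z) \<otimes> x) \<otimes> x = (y \<oplus> z) \<ominus> (x \<otimes> x \<oplus> x \<otimes> x)"
  proof -
    have "x \<otimes> (x \<otimes> (y \<oplus> z)) = (x \<otimes> y \<ominus> x \<otimes> x) \<oplus> \<ominus> (x \<otimes> z \<oplus> x \<otimes> x)"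
      using c by (simp add: mult_r_distr y1 z1 minus_eq r_minus)
    also have "\<dots> = ((y \<ominus> x) \<oplus> (z \<oplus> x)) \<ominus> (x \<otimes> x \<oplus> x \<otimes> x)"
      using c by (simp add: y1 z1 minus_eq minus_add a_ac)
    finally show "x \<otimes> (x \<otimes> (y \<oplus> z)) = (y \<oplus> z) \<ominus> (x \<otimes> x \<oplus> x \<otimes> x)"
      using cancel c by simp
    have "((y \<oplus> z) \<otimes> x) \<otimes> x = (y \<otimes> x \<ominus> x \<otimes> x) \<oplus> \<ominus> (z \<otimes> x \<oplus> x \<otimes> x)"
      using c by (simp add: mult_l_distr y2 z2 minus_eq l_minus)
    also have "\<dots> = ((y \<ominus> x) \<oplus> (z \<oplus> x)) \<ominus> (x \<otimes> x \<oplus> x \<otimes> x)"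
      using c by (simp add: y2 z2 minus_eq minus_add a_ac)
    finally show "((y \<oplus> z) \<otimes> x) \<otimes> x = (y \<oplus> z) \<ominus> (x \<otimes> x \<oplus> x \<otimes> x)"
      using cancel c by simp
  qed
  have "(1/2) \<odot> ((y \<oplus> z) \<ominus> (x \<otimes> x \<oplus> x \<otimes> x)) = (1/2) \<odot> (y \<oplus> z) \<ominus> (x \<otimes> x)"
    unfolding minus_eq using c half_double[of "x \<otimes> x"]
    by (simp only: smult_r_distr[of "y \<oplus> z"] smult_minus a_closed a_inv_closed mult_closed)
  then have half: "(1/2) \<odot> (y \<oplus> z) = x \<otimes> x \<oplus> (1/2) \<odot> ((y \<oplus> z) \<ominus> (x \<otimes> x \<oplus> x \<otimes> x))"
    using c by (simp add: minus_eq a_lcomm[of "x \<otimes> x"] r_neg del: smult_r_distr)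
  have "x \<otimes> x \<otimes> ((1/2) \<odot> (y \<oplus> z)) = (1/2) \<odot> (x \<otimes> (x \<otimes> (y \<oplus> z)))"
    and "(1/2) \<odot> (y \<oplus> z) \<otimes> (x \<otimes> x) = (1/2) \<odot> (((y \<oplus> z) \<otimes> x) \<otimes> x)"
    using c by (simp_all only: smult_mult_right smult_mult_left mult_assoc a_closed mult_closed)
  then show ?thesis
    unfolding quasi_inverse_def double using c half[symmetric] by simp
qed


text \<open>
  By the Lipschitz estimate for the resolvent, the reciprocal of \<open>1 + \<parallel>Q \<kappa>\<parallel>\<close> is a
  \<open>1\<close>-Lipschitz positive function of \<open>\<kappa>\<close>; on the compact unit disc it has a positive minimum.
\<close>

lemma resolvent_bounded:
  assumes k: "k \<in> carrier C" "cnorm C k = 1"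
    and Q: "\<And>\<kappa>. cmod \<kappa> \<le> 1 \<Longrightarrow> quasi_inverse (\<kappa> \<odot> k) (Q \<kappa>)"
  shows "\<exists>K. \<forall>\<kappa>. cmod \<kappa> \<le> 1 \<longrightarrow> 1 + cnorm C (Q \<kappa>) \<le> K"
proof -
  define N where "N \<kappa> = 1 + cnorm C (Q \<kappa>)" for \<kappa>
  have Qc: "Q \<kappa> \<in> carrier C" if "cmod \<kappa> \<le> 1" for \<kappa>
    using Q[OF that] by (simp add: quasi_inverse_def)
  have N1: "1 \<le> N \<kappa>" if "cmod \<kappa> \<le> 1" for \<kappa>
    using cnorm_nonneg[OF Qc[OF that]] by (simp add: N_def)
  have one_sided: "N \<kappa> - N \<mu> \<le> cmod (\<kappa> - \<mu>) * (N \<kappa> * N \<mu>)"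
    if "cmod \<kappa> \<le> 1" "cmod \<mu> \<le> 1" for \<kappa> \<mu>
    using cnorm_le_diff[of "Q \<kappa>" "Q \<mu>"] resolvent_lipschitz[OF k Q[OF that(1)] Q[OF that(2)]]
      Qc that by (simp add: N_def mult.assoc)
  have one_sided': "1 / N \<mu> - 1 / N \<kappa> \<le> cmod (\<kappa> - \<mu>)"
    if "cmod \<kappa> \<le> 1" "cmod \<mu> \<le> 1" for \<kappa> \<mu>
  proof -
    have "0 < N \<kappa>" "0 < N \<mu>" using N1 that by force+
    then show ?thesis using one_sided[OF that] by (simp add: field_simps)
  qed
  have lip: "\<bar>1 / N \<kappa> - 1 / N \<mu>\<bar> \<le> cmod (\<kappa> - \<mu>)"
    if "cmod \<kappa> \<le> 1" "cmod \<mu> \<le> 1" for \<kappa> \<mu>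
    using one_sided'[OF that] one_sided'[OF that(2,1)] norm_minus_commute[of \<kappa> \<mu>] by linarith
  have "continuous_on (cball 0 1) (\<lambda>\<kappa>. 1 / N \<kappa>)"
    unfolding continuous_on_iff
  proof (intro ballI allI impI)
    fix \<mu> :: complex and e :: real assume "\<mu> \<in> cball 0 1" "0 < e"
    then show "\<exists>d>0. \<forall>\<kappa>\<in>cball 0 1. dist \<kappa> \<mu> < d \<longrightarrow> dist (1 / N \<kappa>) (1 / N \<mu>) < e"
      using lip[of _ \<mu>, THEN le_less_trans]
      by (intro exI[of _ e]) (auto simp: dist_norm dist_real_def)
  qed
  then obtain \<mu> where \<mu>: "cmod \<mu> \<le> 1" "\<And>\<kappa>. cmod \<kappa> \<le> 1 \<Longrightarrow> 1 / N \<mu> \<le> 1 / N \<kappa>"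
    using continuous_attains_inf[of "cball 0 1" "\<lambda>\<kappa>. 1 / N \<kappa>"] by auto
  have "N \<kappa> \<le> N \<mu>" if "cmod \<kappa> \<le> 1" for \<kappa>
  proof -
    have "0 < N \<kappa>" "0 < N \<mu>" using N1 that \<mu>(1) by force+
    then show ?thesis using \<mu>(2)[OF that] by (simp add: field_simps)
  qed
  then show ?thesis by (intro exI[of _ "N \<mu>"]) (auto simp: N_def)
qed

text \<open>
  If the resolvent \<open>Q\<close> existed on the whole disc, it would be Lipschitz there, and so would be its
  averages, which are the resolvents of the powers \<open>p n\<close> of order \<open>2\<^sup>n\<close>, with a Lipschitz constant
  that does not depend on \<open>n\<close>. Slightly inside the disc these averages tend to zero, hence they are
  small on the boundary too. But \<open>p n\<close> has norm one because \<open>k\<close> is self-adjoint, and an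
  element of norm one has no quasi-inverse of norm below \<open>1/2\<close>.
\<close>

lemma selfadjoint_not_quasi_invertible:
  assumes k: "k \<in> carrier C" and sa: "star C k = k" and k1: "cnorm C k = 1"
  shows "\<exists>\<kappa>. cmod \<kappa> \<le> 1 \<and> (\<nexists>y. quasi_inverse (\<kappa> \<odot> k) y)"
proof (rule ccontr)
  assume "\<not> ?thesis"
  then obtain Q where Q: "\<And>\<kappa>. cmod \<kappa> \<le> 1 \<Longrightarrow> quasi_inverse (\<kappa> \<odot> k) (Q \<kappa>)"
    by metis
  obtain K where K: "\<And>\<kappa>. cmod \<kappa> \<le> 1 \<Longrightarrow> 1 + cnorm C (Q \<kappa>) \<le> K"
    using resolvent_bounded[OF k k1 Q] by blast
  have Qc: "Q \<kappa> \<in> carrier C" if "cmod \<kappa> \<le> 1" for \<kappa>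
    using Q[OF that] by (simp add: quasi_inverse_def)
  have K1: "1 \<le> K" using K[of 0] cnorm_nonneg[of "Q 0"] Qc[of 0] by simp
  define p where "p = rec_nat k (\<lambda>_ x. x \<otimes> x)"
  have p0: "p 0 = k" and pS: "p (Suc n) = p n \<otimes> p n" for n
    by (simp_all add: p_def)
  have pc: "p n \<in> carrier C" for n
    by (induction n) (simp_all add: p0 pS k)
  have psa: "star C (p n) = p n" for n
    by (induction n) (simp_all add: p0 pS sa star_mult pc)
  have p1: "cnorm C (p n) = 1" for n
    by (induction n) (use cstar_identity[OF pc] in \<open>simp_all add: p0 pS k1 psa\<close>)
  \<comment> \<open>Squaring \<open>n\<close> times turns the radial step from \<open>\<nu>\<close> to \<open>\<nu> t\<close> into one that shrinks the modulus from \<open>1\<close>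
    to the power of \<open>t\<close> of order \<open>2\<^sup>n\<close>. The bound for the initial step survives, because an average of
    differences is no larger than the largest of them; \<open>\<nu>\<close> and \<open>-\<nu>\<close> are the square roots of \<open>\<omega>\<close>.\<close>
  have avg: "\<exists>y z. quasi_inverse (\<omega> \<odot> p n) y \<and> quasi_inverse ((\<omega> * of_real t ^ (2 ^ n)) \<odot> p n) z
      \<and> cnorm C (y \<ominus> z) \<le> K\<^sup>2 * (1 - t)"
    if "cmod \<omega> = 1" "0 \<le> t" "t \<le> 1" for \<omega> t n
    using that(1)
  proof (induction n arbitrary: \<omega>)
    case 0
    have s: "cmod \<omega> \<le> 1" "cmod (\<omega> * of_real t) \<le> 1"
      using 0 that by (simp_all add: norm_mult)
    have "cmod (\<omega> - \<omega> * of_real t) = cmod (\<omega> * of_real (1 - t))"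
      by (simp add: algebra_simps)
    also have "\<dots> = 1 - t" using 0 that(3) by (simp only: norm_mult norm_of_real) simp
    finally have d: "cmod (\<omega> - \<omega> * of_real t) = 1 - t" .
    have "(1 + cnorm C (Q \<omega>)) * (1 + cnorm C (Q (\<omega> * of_real t))) \<le> K * K"
      using K[OF s(1)] K[OF s(2)] cnorm_nonneg[OF Qc[OF s(2)]] K1 by (intro mult_mono) auto
    then have "(1 - t) * ((1 + cnorm C (Q \<omega>)) * (1 + cnorm C (Q (\<omega> * of_real t)))) \<le> (1 - t) * (K * K)"
      using that(3) by (intro mult_left_mono) auto
    then have "cnorm C (Q \<omega> \<ominus> Q (\<omega> * of_real t)) \<le> K\<^sup>2 * (1 - t)"
      using resolvent_lipschitz[OF k k1 Q[OF s(1)] Q[OF s(2)]]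
      by (simp add: d power2_eq_square mult_ac)
    then show ?case using Q[OF s(1)] Q[OF s(2)] by (auto simp: p0)
  next
    case (Suc n)
    define \<nu> where "\<nu> = csqrt \<omega>"
    define T :: complex where "T = of_real t ^ (2 ^ n)"
    have \<nu>: "\<nu> * \<nu> = \<omega>" "cmod \<nu> = 1"
      using power2_csqrt[of \<omega>] Suc.prems by (simp_all add: \<nu>_def power2_eq_square)
    have T2: "\<omega> * of_real t ^ (2 ^ Suc n) = (\<nu> * T) * (\<nu> * T)"
      by (simp add: T_def \<nu>(1)[symmetric] mult_ac power_add[symmetric] mult_2)
    obtain y z where yz: "quasi_inverse (\<nu> \<odot> p n) y" "quasi_inverse ((\<nu> * T) \<odot> p n) z"
      "cnorm C (y \<ominus> z) \<le> K\<^sup>2 * (1 - t)"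
      using Suc.IH[OF \<nu>(2)] by (auto simp: T_def)
    obtain y' z' where yz': "quasi_inverse ((-\<nu>) \<odot> p n) y'" "quasi_inverse ((-\<nu> * T) \<odot> p n) z'"
      "cnorm C (y' \<ominus> z') \<le> K\<^sup>2 * (1 - t)"
      using Suc.IH[of "-\<nu>"] \<nu>(2) by (auto simp: T_def)
    have c: "y \<in> carrier C" "z \<in> carrier C" "y' \<in> carrier C" "z' \<in> carrier C"
      using yz yz' by (auto simp: quasi_inverse_def)
    have neg: "(- \<kappa>) \<odot> p n = \<ominus> (\<kappa> \<odot> p n)" for \<kappa>
      using smult_assoc[OF pc, of "-1" \<kappa> n] by (simp add: minus_eq_smult pc)
    have sq: "(\<kappa> \<odot> p n) \<otimes> (\<kappa> \<odot> p n) = (\<kappa> * \<kappa>) \<odot> p (Suc n)" for \<kappa>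
      by (simp add: pS smult_mult_left smult_mult_right smult_assoc pc)
    have "quasi_inverse (\<omega> \<odot> p (Suc n)) ((1/2) \<odot> (y \<oplus> y'))"
      using quasi_inverse_square[of "\<nu> \<odot> p n" y y'] yz(1) yz'(1) by (simp add: neg sq \<nu>(1))
    moreover have "quasi_inverse ((\<omega> * of_real t ^ (2 ^ Suc n)) \<odot> p (Suc n)) ((1/2) \<odot> (z \<oplus> z'))"
      using quasi_inverse_square[of "(\<nu> * T) \<odot> p n" z z'] yz(2) yz'(2) unfolding T2
      by (simp add: neg sq)
    moreover have "cnorm C ((1/2) \<odot> (y \<oplus> y') \<ominus> (1/2) \<odot> (z \<oplus> z')) \<le> K\<^sup>2 * (1 - t)"
    proof -
      have "(1/2) \<odot> (y \<oplus> y') \<ominus> (1/2) \<odot> (z \<oplus> z') = (1/2) \<odot> ((y \<ominus> z) \<oplus> (y' \<ominus> z'))"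
        using c by (simp add: alg_simps)
      then show ?thesis
        using cnorm_triangle[of "y \<ominus> z" "y' \<ominus> z'"] c yz(3) yz'(3) by (simp add: cnorm_smult)
    qed
    ultimately show ?case by blast
  qed
  \<comment> \<open>The radius \<open>t\<close> makes the variation between it and the boundary at most \<open>1/4\<close>; then
    a high power of \<open>t\<close> pushes the quasi-inverse on the inner circle below \<open>1/4\<close> as well.\<close>
  define t where "t = 1 - 1 / (4 * K\<^sup>2)"
  have K2: "1 \<le> K\<^sup>2" "0 < K\<^sup>2" using K1 by (simp_all add: zero_less_power)
  have t: "0 \<le> t" "t < 1" "K\<^sup>2 * (1 - t) = 1/4"
    using K2 by (auto simp: t_def divide_le_eq_1)
  obtain m where m: "t ^ m < 1/8" using real_arch_pow_inv[of "1/8" t] t by auto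
  have "t ^ (2 ^ m) \<le> t ^ m" using t less_exp[of m] by (intro power_decreasing) auto
  then have small: "t ^ (2 ^ m) < 1/8" using m by simp
  obtain y z where y: "quasi_inverse (1 \<odot> p m) y"
    and z: "quasi_inverse ((1 * of_real t ^ (2 ^ m)) \<odot> p m) z"
    and yz: "cnorm C (y \<ominus> z) \<le> K\<^sup>2 * (1 - t)"
    using avg[of 1 t m] t by auto
  have c: "y \<in> carrier C" "z \<in> carrier C" using y z by (auto simp: quasi_inverse_def)
  have nz: "cnorm C ((1 * of_real t ^ (2 ^ m)) \<odot> p m) = t ^ (2 ^ m)"
    using t(1) by (simp add: cnorm_smult pc p1 norm_power)
  have "cnorm C z \<le> t ^ (2 ^ m) / (1 - t ^ (2 ^ m))"
    using quasi_inverse_norm_bound[OF z] small unfolding nz by simp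
  also have "\<dots> < 1/4" using small by (simp add: field_simps)
  finally have "cnorm C y < 1/2"
    using cnorm_le_diff[OF c] yz t(3) by simp
  moreover have "1 \<le> 2 * cnorm C y"
  proof -
    have "y = p m \<oplus> p m \<otimes> y" using y pc[of m] by (simp add: quasi_inverse_def)
    then have "p m \<otimes> y = y \<ominus> p m" using pc c by (intro add_eq_imp_eq_diff) auto
    then have "cnorm C (p m \<ominus> y) = cnorm C (p m \<otimes> y)" using cnorm_diff_commute pc c by simp
    also have "\<dots> \<le> cnorm C y" using cnorm_mult[of "p m" y] pc c p1 by simp
    finally show ?thesis using cnorm_le_diff[of "p m" y] pc c p1 by simp
  qed
  ultimately show False by simp
qed

end

section \<open>Automatic continuity of star-homomorphisms\<close>

lemma star_hom_diff:
  assumes "cstar_algebra C" "cstar_algebra D" "star_hom C D \<phi>" "x \<in> carrier C" "y \<in> carrier C"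
  shows "\<phi> (x \<ominus>\<^bsub>C\<^esub> y) = \<phi> x \<ominus>\<^bsub>D\<^esub> \<phi> y"
proof -
  interpret C: cstar_algebra C by fact
  interpret D: cstar_algebra D by fact
  have "\<phi> y \<in> carrier D" using assms by (auto simp: star_hom_def)
  then show ?thesis
    using assms C.smult_closed[of y "-1"]
    by (simp add: star_hom_def C.minus_eq D.minus_eq C.minus_eq_smult D.minus_eq_smult)
qed

lemma star_hom_zero:
  assumes "cstar_algebra C" "cstar_algebra D" "star_hom C D \<phi>"
  shows "\<phi> \<zero>\<^bsub>C\<^esub> = \<zero>\<^bsub>D\<^esub>"
proof -
  interpret C: cstar_algebra C by fact
  interpret D: cstar_algebra D by fact
  have "\<phi> (0 \<odot>\<^bsub>C\<^esub> \<zero>\<^bsub>C\<^esub>) = 0 \<odot>\<^bsub>D\<^esub> \<phi> \<zero>\<^bsub>C\<^esub>" "\<phi> \<zero>\<^bsub>C\<^esub> \<in> carrier D"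
    using assms(3) C.zero_closed unfolding star_hom_def by blast+
  then show ?thesis by simp
qed

lemma star_hom_comp:
  assumes "star_hom A B \<phi>" "star_hom B D \<psi>"
  shows "star_hom A D (\<lambda>x. \<psi> (\<phi> x))"
proof -
  have "\<phi> x \<in> carrier B" if "x \<in> carrier A" for x
    using assms(1) that by (auto simp: star_hom_def)
  then show ?thesis using assms by (auto simp: star_hom_def)
qed

lemma star_hom_id: "star_hom C C (\<lambda>x. x)"
  by (simp add: star_hom_def)

text \<open>
  If \<open>\<phi>\<close> increased the norm of a self-adjoint \<open>h\<close>, scale so that \<open>\<phi> h\<close> has norm one. All
  multiples of \<open>h\<close> by numbers in the unit disc then have quasi-inverses, and \<open>\<phi>\<close> maps these to
  quasi-inverses of the multiples of \<open>\<phi> h\<close>, one of which has none. The C*-identity reduces the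
  general case to \<open>x\<^sup>* x\<close>.
\<close>

theorem star_hom_contractive:
  assumes C: "cstar_algebra C" and D: "cstar_algebra D" and \<phi>: "star_hom C D \<phi>"
    and x: "x \<in> carrier C"
  shows "cnorm D (\<phi> x) \<le> cnorm C x"
proof -
  interpret C: cstar_algebra C by fact
  interpret D: cstar_algebra D by fact
  have \<phi>c: "\<phi> z \<in> carrier D" if "z \<in> carrier C" for z
    using \<phi> that by (auto simp: star_hom_def)
  have sa: "cnorm D (\<phi> h) \<le> cnorm C h" if h: "h \<in> carrier C" "star C h = h" for h
  proof (rule ccontr)
    assume "\<not> ?thesis"
    then have less: "cnorm C h < cnorm D (\<phi> h)" by simp
    then have pos: "0 < cnorm D (\<phi> h)" using C.cnorm_nonneg[OF h(1)] by linarith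
    define c :: complex where "c = of_real (1 / cnorm D (\<phi> h))"
    have cm: "cmod c = 1 / cnorm D (\<phi> h)" "cnj c = c"
      unfolding c_def using pos by (simp_all add: norm_divide)
    define k where "k = c \<odot>\<^bsub>D\<^esub> \<phi> h"
    have k: "k \<in> carrier D" "cnorm D k = 1" "k = \<phi> (c \<odot>\<^bsub>C\<^esub> h)"
      using \<phi>c[OF h(1)] pos \<phi> h(1) by (simp_all add: k_def D.cnorm_smult cm star_hom_def)
    have "star D (\<phi> h) = \<phi> h" using \<phi> h unfolding star_hom_def by metis
    then have "star D k = k" using \<phi>c[OF h(1)] by (simp add: k_def D.star_smult cm)
    then obtain \<kappa> where \<kappa>: "cmod \<kappa> \<le> 1" "\<nexists>y. D.quasi_inverse (\<kappa> \<odot>\<^bsub>D\<^esub> k) y"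
      using D.selfadjoint_not_quasi_invertible[OF k(1) _ k(2)] by blast
    define u where "u = \<kappa> \<odot>\<^bsub>C\<^esub> (c \<odot>\<^bsub>C\<^esub> h)"
    have u: "u \<in> carrier C" "\<phi> u = \<kappa> \<odot>\<^bsub>D\<^esub> k"
      using h \<phi> k(3) by (simp_all add: u_def star_hom_def)
    have "cnorm C u = cmod \<kappa> * (cnorm C h / cnorm D (\<phi> h))"
      using h(1) by (simp add: u_def C.cnorm_smult cm)
    also have "\<dots> \<le> 1 * (cnorm C h / cnorm D (\<phi> h))"
      using \<kappa>(1) pos C.cnorm_nonneg[OF h(1)] by (intro mult_right_mono) auto
    also have "\<dots> < 1" using less pos by simp
    finally obtain y where y: "C.quasi_inverse u y"
      using C.quasi_inverse_exists[OF u(1)] by blast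
    then have yc: "y \<in> carrier C" "y = u \<oplus>\<^bsub>C\<^esub> u \<otimes>\<^bsub>C\<^esub> y" "y = u \<oplus>\<^bsub>C\<^esub> y \<otimes>\<^bsub>C\<^esub> u"
      unfolding C.quasi_inverse_def by blast+
    have "\<phi> (u \<oplus>\<^bsub>C\<^esub> u \<otimes>\<^bsub>C\<^esub> y) = \<phi> u \<oplus>\<^bsub>D\<^esub> \<phi> u \<otimes>\<^bsub>D\<^esub> \<phi> y"
      "\<phi> (u \<oplus>\<^bsub>C\<^esub> y \<otimes>\<^bsub>C\<^esub> u) = \<phi> u \<oplus>\<^bsub>D\<^esub> \<phi> y \<otimes>\<^bsub>D\<^esub> \<phi> u"
      using \<phi> u(1) yc(1) by (simp_all add: star_hom_def)
    then have "D.quasi_inverse (\<phi> u) (\<phi> y)"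
      using yc \<phi>c u(1) unfolding D.quasi_inverse_def by metis
    then show False using \<kappa>(2) u(2) by auto
  qed
  have "(cnorm D (\<phi> x))\<^sup>2 = cnorm D (\<phi> (star C x \<otimes>\<^bsub>C\<^esub> x))"
    using D.cstar_identity[OF \<phi>c[OF x]] \<phi> x by (simp add: star_hom_def)
  also have "\<dots> \<le> cnorm C (star C x \<otimes>\<^bsub>C\<^esub> x)"
    using x by (intro sa) (simp_all add: C.star_mult)
  also have "\<dots> = (cnorm C x)\<^sup>2" by (rule C.cstar_identity[OF x])
  finally show ?thesis using C.cnorm_nonneg[OF x] by (rule power2_le_imp_le)
qed

text \<open>Continuity makes the set on which two star-homomorphisms agree closed.\<close>

theorem star_hom_eq_on_generated:
  assumes C: "cstar_algebra C" and D: "cstar_algebra D"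
    and \<phi>: "star_hom C D \<phi>" and \<psi>: "star_hom C D \<psi>"
    and G: "G \<subseteq> carrier C" and eq: "\<And>g. g \<in> G \<Longrightarrow> \<phi> g = \<psi> g"
    and x: "x \<in> cstar_generated C G"
  shows "\<phi> x = \<psi> x"
proof -
  interpret C: cstar_algebra C by fact
  interpret D: cstar_algebra D by fact
  define S where "S = {x \<in> carrier C. \<phi> x = \<psi> x}"
  have limit: "y \<in> S" if X: "range X \<subseteq> S" and y: "y \<in> carrier C"
    and lim: "(\<lambda>n. cnorm C (X n \<ominus>\<^bsub>C\<^esub> y)) \<longlonglongrightarrow> 0" for X y
  proof -
    have Xc: "X n \<in> carrier C" "\<phi> (X n) = \<psi> (X n)" for n
      using X by (auto simp: S_def)
    have im: "\<phi> z \<in> carrier D" "\<psi> z \<in> carrier D" if "z \<in> carrier C" for z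
      using \<phi> \<psi> that by (auto simp: star_hom_def)
    have conv: "(\<lambda>n. cnorm D (\<theta> (X n) \<ominus>\<^bsub>D\<^esub> \<theta> y)) \<longlonglongrightarrow> 0" if \<theta>: "star_hom C D \<theta>" for \<theta>
    proof -
      have "cnorm D (\<theta> (X n) \<ominus>\<^bsub>D\<^esub> \<theta> y) \<le> cnorm C (X n \<ominus>\<^bsub>C\<^esub> y)" for n
        using star_hom_contractive[OF C D \<theta>, of "X n \<ominus>\<^bsub>C\<^esub> y"] star_hom_diff[OF C D \<theta> Xc(1) y] Xc y
        by simp
      moreover have "0 \<le> cnorm D (\<theta> (X n) \<ominus>\<^bsub>D\<^esub> \<theta> y)" for n
        using \<theta> Xc(1) y by (intro D.cnorm_nonneg D.minus_closed) (auto simp: star_hom_def)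
      ultimately show ?thesis
        by (intro tendsto_sandwich[OF always_eventually always_eventually tendsto_const lim]) blast+
    qed
    have "\<phi> y = \<psi> y"
      using D.limit_unique[of "\<lambda>n. \<phi> (X n)" "\<phi> y" "\<psi> y"] conv[OF \<phi>] conv[OF \<psi>] im Xc y by simp
    then show ?thesis using y by (simp add: S_def)
  qed
  have "closed_star_subalgebra C S"
    unfolding closed_star_subalgebra_def
  proof (intro conjI)
    show "\<zero>\<^bsub>C\<^esub> \<in> S"
      using star_hom_zero[OF C D \<phi>] star_hom_zero[OF C D \<psi>] by (simp add: S_def)
    show "\<forall>X x. range X \<subseteq> S \<and> x \<in> carrier C \<and> (\<lambda>n. cnorm C (X n \<ominus>\<^bsub>C\<^esub> x)) \<longlonglongrightarrow> 0 \<longrightarrow> x \<in> S"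
      using limit by blast
  qed (use \<phi> \<psi> in \<open>auto simp: S_def star_hom_def\<close>)
  moreover have "G \<subseteq> S" using G eq by (auto simp: S_def)
  ultimately show ?thesis using x unfolding cstar_generated_def S_def by blast
qed


section \<open>Extending projections from a lattice of sets to the ring it generates\<close>

lemma (in cstar_algebra) mult_finsum:
  assumes "finite F" "x \<in> carrier C" "\<And>i. i \<in> F \<Longrightarrow> f i \<in> carrier C"
  shows "x \<otimes> (\<Oplus>i\<in>F. f i) = (\<Oplus>i\<in>F. x \<otimes> f i)"
  using assms(1,3)
proof (induction F rule: finite_induct)
  case empty
  then show ?case using assms(2) by simp
next
  case (insert i F)
  then have "f \<in> F \<rightarrow> carrier C" "(\<lambda>i. x \<otimes> f i) \<in> F \<rightarrow> carrier C" using assms(2) by auto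
  then show ?case using insert assms(2) by (simp add: finsum_insert finsum_closed mult_r_distr)
qed

text \<open>The projections commute, because intersections do not depend on the order.\<close>

locale projection_lattice = cstar_algebra C for C :: "'c star_algebra" (structure) +
  fixes B :: "'v set set" and p :: "'v set \<Rightarrow> 'c"
  assumes B_empty: "{} \<in> B"
    and B_Un: "X \<in> B \<Longrightarrow> Y \<in> B \<Longrightarrow> X \<union> Y \<in> B"
    and B_Int: "X \<in> B \<Longrightarrow> Y \<in> B \<Longrightarrow> X \<inter> Y \<in> B"
    and p_projection: "X \<in> B \<Longrightarrow> is_projection C (p X)"
    and p_empty: "p {} = \<zero>"
    and p_mult: "X \<in> B \<Longrightarrow> Y \<in> B \<Longrightarrow> p X \<otimes> p Y = p (X \<inter> Y)"
    and p_Un: "X \<in> B \<Longrightarrow> Y \<in> B \<Longrightarrow> p (X \<union> Y) = p X \<oplus> p Y \<ominus> p (X \<inter> Y)"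
begin

lemma p_closed [simp]: "X \<in> B \<Longrightarrow> p X \<in> carrier C"
  using p_projection by (auto simp: is_projection_def)

text \<open>
  The pairs of a set in the ring generated by \<open>B\<close> and a value that it is forced to have. That a set
  has only one value is a theorem below. Unions are generated only when the values are
  orthogonal, in which case the join is a sum; general unions are then derived. Orthogonality is a
  separate premise, because it follows from disjointness only once uniqueness is known.
\<close>

inductive extends_to :: "'v set \<Rightarrow> 'c \<Rightarrow> bool" where
  base: "X \<in> B \<Longrightarrow> extends_to X (p X)"
| disjoint_union: "extends_to Z x \<Longrightarrow> extends_to W y \<Longrightarrow> Z \<inter> W = {} \<Longrightarrow> x \<otimes> y = \<zero> \<Longrightarrow>
    extends_to (Z \<union> W) (x \<oplus> y)"
| diff: "extends_to Z x \<Longrightarrow> extends_to W y \<Longrightarrow> extends_to (Z - W) (x \<ominus> x \<otimes> y)"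

lemma extends_to_closed: "extends_to Z x \<Longrightarrow> x \<in> carrier C"
  by (induction rule: extends_to.induct) simp_all

lemma commute_sum_diff:
  assumes "u \<in> carrier C" "x \<in> carrier C" "y \<in> carrier C"
    and x: "x \<otimes> u = u \<otimes> x" and y: "y \<otimes> u = u \<otimes> y"
  shows "(x \<oplus> y) \<otimes> u = u \<otimes> (x \<oplus> y)" "(x \<ominus> x \<otimes> y) \<otimes> u = u \<otimes> (x \<ominus> x \<otimes> y)"
proof -
  show "(x \<oplus> y) \<otimes> u = u \<otimes> (x \<oplus> y)"
    using assms by (simp add: mult_l_distr mult_r_distr)
  have "x \<otimes> y \<otimes> u = u \<otimes> (x \<otimes> y)"
    using assms by (metis mult_assoc)
  then show "(x \<ominus> x \<otimes> y) \<otimes> u = u \<otimes> (x \<ominus> x \<otimes> y)"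
    using assms(1-3) x by (simp add: minus_eq mult_l_distr mult_r_distr l_minus r_minus)
qed

lemma extends_to_commute_base:
  "extends_to Z x \<Longrightarrow> X \<in> B \<Longrightarrow> x \<otimes> p X = p X \<otimes> x"
  by (induction rule: extends_to.induct)
    (simp_all add: commute_sum_diff extends_to_closed p_mult Int_commute)

lemma extends_to_commute:
  "extends_to Z x \<Longrightarrow> extends_to W y \<Longrightarrow> x \<otimes> y = y \<otimes> x"
  by (induction rule: extends_to.induct)
    (simp_all add: commute_sum_diff extends_to_closed extends_to_commute_base)

lemma extends_to_projection:
  "extends_to Z x \<Longrightarrow> star C x = x \<and> x \<otimes> x = x"
proof (induction rule: extends_to.induct)
  case (base X)
  then show ?case using p_projection by (simp add: is_projection_def)
next
  case (disjoint_union Z x W y)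
  have c: "x \<in> carrier C" "y \<in> carrier C" using disjoint_union extends_to_closed by auto
  have "y \<otimes> x = \<zero>" using extends_to_commute disjoint_union by metis
  then show ?case using disjoint_union c by (simp add: star_add mult_l_distr mult_r_distr)
next
  case (diff Z x W y)
  define e where "e = x \<otimes> y"
  have c: "x \<in> carrier C" "y \<in> carrier C" using diff extends_to_closed by auto
  have yx: "y \<otimes> x = x \<otimes> y" using extends_to_commute diff by metis
  have xe: "x \<otimes> e = e" using diff.IH c by (simp add: e_def mult_assoc[symmetric])
  then have ex: "e \<otimes> x = e" using c by (simp add: e_def mult_assoc yx)
  have ey: "e \<otimes> y = e" using diff.IH c by (simp add: e_def mult_assoc)
  have ec: "e \<in> carrier C" using c by (simp add: e_def)
  have "e \<otimes> e = (e \<otimes> x) \<otimes> y" using c ec by (simp add: mult_assoc e_def)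
  then have ee: "e \<otimes> e = e" by (simp add: ex ey)
  have se: "star C e = e" using diff.IH c yx by (simp add: e_def star_mult)
  have "star C (x \<ominus> e) = x \<ominus> e"
    using c ec diff.IH se by (simp add: minus_eq star_add star_minus)
  moreover have "(x \<ominus> e) \<otimes> (x \<ominus> e) = x \<ominus> e"
    using c ec xe ex ee diff.IH by (simp add: minus_eq mult_l_distr mult_r_distr l_minus r_minus r_neg l_neg)
  ultimately show ?case by (simp add: e_def)
qed

text \<open>The value that \<open>X - Y\<close> is forced to have.\<close>

definition cell :: "'v set \<Rightarrow> 'v set \<Rightarrow> 'c" where
  "cell X Y = p X \<ominus> p (X \<inter> Y)"

lemma cell_closed [simp]: "X \<in> B \<Longrightarrow> Y \<in> B \<Longrightarrow> cell X Y \<in> carrier C"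
  by (simp add: cell_def B_Int)

lemma cell_eq_zero:
  assumes "X \<in> B" "X \<subseteq> Y"
  shows "cell X Y = \<zero>"
proof -
  have "X \<inter> Y = X" using assms by blast
  then show ?thesis using assms by (simp add: cell_def minus_eq r_neg)
qed

lemma cell_split:
  assumes "X \<in> B" "Y \<in> B" "A \<in> B"
  shows "cell X Y = cell (X \<inter> A) Y \<oplus> cell X (Y \<union> A)"
proof -
  have "X \<inter> (Y \<union> A) = (X \<inter> Y) \<union> (X \<inter> A)" "(X \<inter> Y) \<inter> (X \<inter> A) = X \<inter> A \<inter> Y" by blast+
  then have e: "p (X \<inter> (Y \<union> A)) = p (X \<inter> Y) \<oplus> (p (X \<inter> A) \<ominus> p (X \<inter> A \<inter> Y))"
    using p_Un[of "X \<inter> Y" "X \<inter> A"] assms by (simp add: B_Int minus_eq a_assoc)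
  define d where "d = p (X \<inter> A) \<ominus> p (X \<inter> A \<inter> Y)"
  have c: "d \<in> carrier C" "p X \<in> carrier C" "p (X \<inter> Y) \<in> carrier C"
    using assms by (simp_all add: d_def B_Int)
  have "d \<oplus> (p X \<ominus> (p (X \<inter> Y) \<oplus> d)) = p X \<ominus> p (X \<inter> Y)"
    using c a_lcomm[of d "p X" "\<ominus> d \<oplus> \<ominus> p (X \<inter> Y)"]
    by (simp add: minus_eq minus_add a_comm[of "\<ominus> p (X \<inter> Y)"] r_neg2)
  then show ?thesis by (simp add: cell_def e d_def)
qed

lemma cell_mult_p:
  assumes "X \<in> B" "Y \<in> B" "A \<in> B"
  shows "cell X Y \<otimes> p A = cell (X \<inter> A) Y"
proof -
  have "X \<inter> Y \<inter> A = X \<inter> A \<inter> Y" by blast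
  then show ?thesis
    using assms by (simp add: cell_def minus_eq mult_l_distr l_minus B_Int p_mult)
qed

lemma cell_mult_cell:
  assumes "X \<in> B" "Y \<in> B" "X' \<in> B" "Y' \<in> B"
  shows "cell X' Y' \<otimes> cell X Y = cell (X \<inter> X') (Y \<union> Y')"
proof -
  have i: "X' \<inter> (X \<inter> Y) = X' \<inter> X \<inter> Y" by blast
  have "cell X' Y' \<otimes> cell X Y = cell (X' \<inter> X) Y' \<ominus> cell (X' \<inter> X \<inter> Y) Y'"
    unfolding cell_def[of X Y] using assms
    by (simp add: minus_eq mult_r_distr r_minus cell_mult_p B_Int i)
  also have "\<dots> = cell (X' \<inter> X) (Y' \<union> Y)"
    unfolding cell_split[OF B_Int[OF assms(3,1)] assms(4,2)] using assms
    by (simp add: minus_eq B_Int B_Un a_assoc a_comm[of "cell (X' \<inter> X \<inter> Y) Y'"] r_neg)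
  finally show ?thesis by (simp add: Int_commute Un_commute)
qed

text \<open>
  The indicator of \<open>Z\<close> is constant on the cell, and \<open>x\<close> acts there as that constant. An empty cell
  satisfies both alternatives, since its projection is zero.
\<close>

definition decides :: "'v set \<Rightarrow> 'v set \<Rightarrow> 'v set \<Rightarrow> 'c \<Rightarrow> bool" where
  "decides X Y Z x \<longleftrightarrow>
     (X - Y \<subseteq> Z \<and> cell X Y \<otimes> x = cell X Y) \<or> ((X - Y) \<inter> Z = {} \<and> cell X Y \<otimes> x = \<zero>)"

lemma decides_refine:
  assumes dec: "decides X Y Z x" and B: "X \<in> B" "Y \<in> B" "X' \<in> B" "Y' \<in> B" and x: "x \<in> carrier C"
  shows "decides (X \<inter> X') (Y \<union> Y') Z x"
proof -
  have "cell (X \<inter> X') (Y \<union> Y') \<otimes> x = cell X' Y' \<otimes> (cell X Y \<otimes> x)"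
    using B x by (simp add: cell_mult_cell[symmetric] mult_assoc)
  moreover have "X \<inter> X' - (Y \<union> Y') \<subseteq> X - Y" by blast
  ultimately show ?thesis
    using dec cell_mult_cell[OF B] cell_closed[OF B(3,4)] unfolding decides_def
    by (elim disjE conjE) (metis order_trans, metis disjoint_iff r_null subsetD)
qed

lemma decides_p:
  assumes "X \<in> B" "Y \<in> B" "A \<in> B"
  shows "decides (X \<inter> A) Y A (p A)" "decides X (Y \<union> A) A (p A)"
proof -
  show "decides (X \<inter> A) Y A (p A)"
    using assms by (auto simp: decides_def cell_mult_p B_Int)
  have "cell (X \<inter> A) (Y \<union> A) = \<zero>" using assms by (intro cell_eq_zero B_Int) auto
  then show "decides X (Y \<union> A) A (p A)"
    using assms by (auto simp: decides_def cell_mult_p B_Un)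
qed

text \<open>
  A property of cells that holds for a cell as soon as it holds for the two parts into which a member
  of \<open>B\<close> cuts that cell. Being annihilated by a fixed element is such a property.
\<close>

definition splitting :: "('v set \<Rightarrow> 'v set \<Rightarrow> bool) \<Rightarrow> bool" where
  "splitting T \<longleftrightarrow> (\<forall>X\<in>B. \<forall>Y\<in>B. \<forall>A\<in>B. T (X \<inter> A) Y \<and> T X (Y \<union> A) \<longrightarrow> T X Y)"

lemma splittingD:
  "splitting T \<Longrightarrow> X \<in> B \<Longrightarrow> Y \<in> B \<Longrightarrow> A \<in> B \<Longrightarrow> T (X \<inter> A) Y \<Longrightarrow> T X (Y \<union> A) \<Longrightarrow> T X Y"
  unfolding splitting_def by blast

text \<open>
  Every cell can be cut, in finitely many steps, into cells that decide \<open>(Z, x)\<close>. Instead of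
  finite partitions this is expressed as the induction principle that they provide.
\<close>

definition decidable :: "'v set \<Rightarrow> 'c \<Rightarrow> bool" where
  "decidable Z x \<longleftrightarrow>
     (\<forall>T. splitting T \<and> (\<forall>X\<in>B. \<forall>Y\<in>B. decides X Y Z x \<longrightarrow> T X Y) \<longrightarrow> (\<forall>X\<in>B. \<forall>Y\<in>B. T X Y))"

lemma decidableI:
  assumes "\<And>T X Y. splitting T \<Longrightarrow> (\<And>X Y. X \<in> B \<Longrightarrow> Y \<in> B \<Longrightarrow> decides X Y Z x \<Longrightarrow> T X Y) \<Longrightarrow>
    X \<in> B \<Longrightarrow> Y \<in> B \<Longrightarrow> T X Y"
  shows "decidable Z x"
  unfolding decidable_def using assms by (intro allI impI ballI) (elim conjE, metis)

lemma decidableD: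
  assumes "decidable Z x" "splitting T"
    and "\<And>X Y. X \<in> B \<Longrightarrow> Y \<in> B \<Longrightarrow> decides X Y Z x \<Longrightarrow> T X Y" "X \<in> B" "Y \<in> B"
  shows "T X Y"
  using assms(1)[unfolded decidable_def, THEN spec, of T] assms(2-) by simp

text \<open>
  Two partitions have a common refinement: fix a cell that decides \<open>Z\<close>, and cut it along the
  partition that decides \<open>W\<close>.
\<close>

lemma decidable_pair:
  assumes Z: "decidable Z x" and W: "decidable W y"
    and c: "x \<in> carrier C" "y \<in> carrier C" and T: "splitting T"
    and both: "\<And>X Y. X \<in> B \<Longrightarrow> Y \<in> B \<Longrightarrow> decides X Y Z x \<Longrightarrow> decides X Y W y \<Longrightarrow> T X Y"
    and B: "X \<in> B" "Y \<in> B"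
  shows "T X Y"
proof -
  have "T U V" if UV: "U \<in> B" "V \<in> B" "decides U V Z x" for U V
  proof -
    define T' where "T' X' Y' \<longleftrightarrow> T (U \<inter> X') (V \<union> Y')" for X' Y'
    have "splitting T'"
      unfolding splitting_def
    proof (intro ballI impI)
      fix X' Y' A assume a: "X' \<in> B" "Y' \<in> B" "A \<in> B" "T' (X' \<inter> A) Y' \<and> T' X' (Y' \<union> A)"
      then have t: "T (U \<inter> X' \<inter> A) (V \<union> Y')" "T (U \<inter> X') (V \<union> Y' \<union> A)"
        by (simp_all add: T'_def Int_assoc Un_assoc)
      have "U \<inter> X' \<in> B" "V \<union> Y' \<in> B" using UV a by (simp_all add: B_Int B_Un)
      from splittingD[OF T this a(3) t] show "T' X' Y'" by (simp add: T'_def)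
    qed
    moreover have "T' X' Y'" if a: "X' \<in> B" "Y' \<in> B" "decides X' Y' W y" for X' Y'
    proof -
      have "decides (U \<inter> X') (V \<union> Y') Z x" using decides_refine[OF UV(3,1,2) a(1,2) c(1)] .
      moreover have "decides (U \<inter> X') (V \<union> Y') W y"
        using decides_refine[OF a(3,1,2) UV(1,2) c(2)] by (simp add: Int_commute Un_commute)
      ultimately show ?thesis
        unfolding T'_def by (intro both B_Int B_Un UV a)
    qed
    ultimately have "T' U V" by (rule decidableD[OF W _ _ UV(1,2)])
    then show ?thesis by (simp add: T'_def)
  qed
  then show ?thesis by (rule decidableD[OF Z T _ B])
qed

lemma extends_to_decidable: "extends_to Z x \<Longrightarrow> decidable Z x"
proof (induction rule: extends_to.induct)
  case (base A)
  then show ?case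
  proof (intro decidableI)
    fix T X Y
    assume T: "splitting T" "\<And>X Y. X \<in> B \<Longrightarrow> Y \<in> B \<Longrightarrow> decides X Y A (p A) \<Longrightarrow> T X Y"
      and B: "X \<in> B" "Y \<in> B"
    have "T (X \<inter> A) Y" "T X (Y \<union> A)"
      using decides_p[OF B base] B base by (auto intro!: T(2) B_Int B_Un)
    then show "T X Y" by (rule splittingD[OF T(1) B base])
  qed
next
  case (disjoint_union Z x W y)
  have c: "x \<in> carrier C" "y \<in> carrier C" using disjoint_union extends_to_closed by auto
  have "decides X Y (Z \<union> W) (x \<oplus> y)"
    if B: "X \<in> B" "Y \<in> B" and d: "decides X Y Z x" "decides X Y W y" for X Y
  proof (cases "X \<subseteq> Y")
    case True
    then show ?thesis using cell_eq_zero[OF B(1) True] c by (auto simp: decides_def)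
  next
    case False
    have "cell X Y \<otimes> (x \<oplus> y) = cell X Y \<otimes> x \<oplus> cell X Y \<otimes> y"
      using B c by (simp add: mult_r_distr)
    moreover have "\<not> (X - Y \<subseteq> Z \<and> X - Y \<subseteq> W)"
      using False disjoint_union by blast
    ultimately show ?thesis using d B by (auto simp: decides_def)
  qed
  note dec = this
  show ?case
  proof (intro decidableI)
    fix T X Y
    assume T: "splitting T" and imp: "\<And>X Y. X \<in> B \<Longrightarrow> Y \<in> B \<Longrightarrow> decides X Y (Z \<union> W) (x \<oplus> y) \<Longrightarrow> T X Y"
      and B: "X \<in> B" "Y \<in> B"
    show "T X Y"
      by (rule decidable_pair[OF disjoint_union.IH c T _ B]) (rule imp[OF _ _ dec])
  qed
next
  case (diff Z x W y)
  have c: "x \<in> carrier C" "y \<in> carrier C" using diff extends_to_closed by auto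
  have "decides X Y (Z - W) (x \<ominus> x \<otimes> y)"
    if B: "X \<in> B" "Y \<in> B" and d: "decides X Y Z x" "decides X Y W y" for X Y
  proof -
    have "cell X Y \<otimes> (x \<ominus> x \<otimes> y) = cell X Y \<otimes> x \<ominus> (cell X Y \<otimes> x) \<otimes> y"
      using B c by (simp add: minus_eq mult_r_distr r_minus mult_assoc)
    then show ?thesis using d B c by (auto simp: decides_def minus_eq r_neg)
  qed
  note dec = this
  show ?case
  proof (intro decidableI)
    fix T X Y
    assume T: "splitting T" and imp: "\<And>X Y. X \<in> B \<Longrightarrow> Y \<in> B \<Longrightarrow> decides X Y (Z - W) (x \<ominus> x \<otimes> y) \<Longrightarrow> T X Y"
      and B: "X \<in> B" "Y \<in> B"
    show "T X Y"
      by (rule decidable_pair[OF diff.IH c T _ B]) (rule imp[OF _ _ dec])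
  qed
qed

lemma extends_to_bounded: "extends_to Z x \<Longrightarrow> \<exists>X\<in>B. Z \<subseteq> X \<and> p X \<otimes> x = x"
proof (induction rule: extends_to.induct)
  case (base X)
  then show ?case by (intro bexI[of _ X]) (simp_all add: p_mult)
next
  case (disjoint_union Z x W y)
  have c: "x \<in> carrier C" "y \<in> carrier C" using disjoint_union extends_to_closed by auto
  from disjoint_union.IH obtain X Y
    where X: "X \<in> B" "Z \<subseteq> X" "p X \<otimes> x = x" and Y: "Y \<in> B" "W \<subseteq> Y" "p Y \<otimes> y = y" by blast
  have "(X \<union> Y) \<inter> X = X" "(X \<union> Y) \<inter> Y = Y" by blast+
  then have "p (X \<union> Y) \<otimes> p X = p X" "p (X \<union> Y) \<otimes> p Y = p Y"
    using X Y by (simp_all add: p_mult B_Un)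
  then have "p (X \<union> Y) \<otimes> x = x" "p (X \<union> Y) \<otimes> y = y"
    using X Y c by (metis B_Un mult_assoc p_closed)+
  then have "p (X \<union> Y) \<otimes> (x \<oplus> y) = x \<oplus> y" using X Y c by (simp add: mult_r_distr B_Un)
  moreover have "X \<union> Y \<in> B" "Z \<union> W \<subseteq> X \<union> Y" using X Y B_Un by auto
  ultimately show ?case by blast
next
  case (diff Z x W y)
  have c: "x \<in> carrier C" "y \<in> carrier C" using diff extends_to_closed by auto
  from diff.IH obtain X where X: "X \<in> B" "Z \<subseteq> X" "p X \<otimes> x = x" by blast
  then have "p X \<otimes> (x \<ominus> x \<otimes> y) = x \<ominus> x \<otimes> y"
    using c by (simp add: minus_eq mult_r_distr r_minus mult_assoc[symmetric])
  then show ?case using X by blast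
qed

text \<open>
  A cell that decides \<open>({}, x)\<close> annihilates \<open>x\<close>, either by definition or because the cell is empty and
  its projection vanishes. Cutting shows that all cells annihilate \<open>x\<close>, among them the members
  of \<open>B\<close>, and one of these dominates \<open>x\<close>.
\<close>

lemma extends_to_empty:
  assumes "extends_to {} x"
  shows "x = \<zero>"
proof -
  have c: "x \<in> carrier C" using assms extends_to_closed by blast
  define T where "T X Y \<longleftrightarrow> cell X Y \<otimes> x = \<zero>" for X Y
  have "splitting T"
    unfolding splitting_def T_def
  proof (intro ballI impI)
    fix X Y A assume a: "X \<in> B" "Y \<in> B" "A \<in> B"
      and "cell (X \<inter> A) Y \<otimes> x = \<zero> \<and> cell X (Y \<union> A) \<otimes> x = \<zero>"
    then show "cell X Y \<otimes> x = \<zero>"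
      unfolding cell_split[OF a] using c by (simp add: B_Int B_Un mult_l_distr)
  qed
  moreover have "T X Y" if "X \<in> B" "Y \<in> B" "decides X Y {} x" for X Y
    using that cell_eq_zero[of X Y] c unfolding T_def decides_def by auto
  ultimately have T: "T X {}" if "X \<in> B" for X
    using decidableD[OF extends_to_decidable[OF assms]] that B_empty by blast
  obtain X where "X \<in> B" "p X \<otimes> x = x" using extends_to_bounded[OF assms] by blast
  then show ?thesis using T[of X] c by (simp add: T_def cell_def p_empty minus_eq)
qed

text \<open>
  The set \<open>Z - Z\<close> has the values \<open>x - x y\<close> and \<open>y - y x\<close>, which therefore vanish.
\<close>

theorem extends_to_unique:
  assumes "extends_to Z x" "extends_to Z y"
  shows "x = y"
proof -
  have c: "x \<in> carrier C" "y \<in> carrier C" using assms extends_to_closed by auto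
  have "x \<ominus> x \<otimes> y = \<zero>" "y \<ominus> y \<otimes> x = \<zero>"
    using diff[OF assms] diff[OF assms(2,1)] by (auto intro: extends_to_empty)
  then have "x = x \<otimes> y" "y = y \<otimes> x" using c by (auto intro: diff_eq_zeroD)
  then show ?thesis using extends_to_commute[OF assms] by simp
qed

lemma extends_to_Int:
  assumes "extends_to Z x" "extends_to W y"
  shows "extends_to (Z \<inter> W) (x \<otimes> y)"
proof -
  have c: "x \<in> carrier C" "y \<in> carrier C" using assms extends_to_closed by auto
  have "x \<ominus> x \<otimes> (x \<ominus> x \<otimes> y) = x \<otimes> y"
    using c extends_to_projection[OF assms(1)]
    by (simp add: minus_eq mult_r_distr r_minus mult_assoc[symmetric] minus_add minus_minus r_neg2)
  moreover have "Z - (Z - W) = Z \<inter> W" by blast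
  ultimately show ?thesis using diff[OF assms(1) diff[OF assms]] by simp
qed

lemma extends_to_Un:
  assumes "extends_to Z x" "extends_to W y"
  shows "extends_to (Z \<union> W) (x \<oplus> y \<ominus> x \<otimes> y)"
proof -
  have c: "x \<in> carrier C" "y \<in> carrier C" using assms extends_to_closed by auto
  have yx: "y \<otimes> x = x \<otimes> y" using extends_to_commute assms by metis
  have "x \<otimes> (y \<ominus> y \<otimes> x) = \<zero>"
    using c extends_to_projection[OF assms(1)]
    by (simp add: minus_eq mult_r_distr r_minus yx mult_assoc[symmetric] r_neg)
  then have "extends_to (Z \<union> (W - Z)) (x \<oplus> (y \<ominus> y \<otimes> x))"
    by (intro disjoint_union diff assms) auto
  then show ?thesis using c by (simp add: minus_eq a_assoc yx)
qed

end


section \<open>Labelled spaces and their representations\<close>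

lemma rel_range_empty [simp]: "rel_range E L {} \<alpha> = {}"
  by (simp add: rel_range_def)

lemma rel_range_Un: "rel_range E L (X \<union> Y) \<alpha> = rel_range E L X \<alpha> \<union> rel_range E L Y \<alpha>"
  unfolding rel_range_def by blast

lemma rel_range_mono: "X \<subseteq> Y \<Longrightarrow> rel_range E L X \<alpha> \<subseteq> rel_range E L Y \<alpha>"
  unfolding rel_range_def by blast

lemma accommodatingD:
  assumes "accommodating E L B"
  shows "B \<subseteq> Pow (verts E)" "{} \<in> B"
    and "\<alpha> \<in> label_words E L \<Longrightarrow> word_range E L \<alpha> \<in> B"
    and "X \<in> B \<Longrightarrow> \<alpha> \<in> label_words E L \<Longrightarrow> rel_range E L X \<alpha> \<in> B"
    and "X \<in> B \<Longrightarrow> Y \<in> B \<Longrightarrow> X \<union> Y \<in> B"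
    and "X \<in> B \<Longrightarrow> Y \<in> B \<Longrightarrow> X \<inter> Y \<in> B"
  using assms unfolding accommodating_def by blast+

lemma weakly_left_resolving_Diff:
  assumes wlr: "weakly_left_resolving E L B" and \<alpha>: "\<alpha> \<in> label_words E L"
    and B: "X \<in> B" "Y \<in> B" "X - Y \<in> B"
  shows "rel_range E L (X - Y) \<alpha> = rel_range E L X \<alpha> - rel_range E L Y \<alpha>"
proof -
  have "rel_range E L (X - Y) \<alpha> \<inter> rel_range E L Y \<alpha> = rel_range E L ((X - Y) \<inter> Y) \<alpha>"
    using wlr B \<alpha> unfolding weakly_left_resolving_def by blast
  also have "(X - Y) \<inter> Y = {}" by blast
  finally have disj: "rel_range E L (X - Y) \<alpha> \<inter> rel_range E L Y \<alpha> = {}" by simp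
  have "rel_range E L X \<alpha> \<subseteq> rel_range E L (X - Y) \<alpha> \<union> rel_range E L Y \<alpha>"
    unfolding rel_range_Un[symmetric] by (rule rel_range_mono) blast
  then show ?thesis using disj rel_range_mono[of "X - Y" X E L \<alpha>] by blast
qed

lemma E0minus_subset_Ebar: "E0minus E L \<subseteq> Ebar E L"
  unfolding E0minus_def Ebar_def by blast

lemma representationD:
  assumes "representation E L Al B C p s"
  shows "X \<in> B \<Longrightarrow> is_projection C (p X)"
    and "a \<in> Al \<Longrightarrow> is_partial_isometry C (s a)"
    and "p {} = \<zero>\<^bsub>C\<^esub>"
    and "X \<in> B \<Longrightarrow> Y \<in> B \<Longrightarrow> p X \<otimes>\<^bsub>C\<^esub> p Y = p (X \<inter> Y)"
    and "X \<in> B \<Longrightarrow> Y \<in> B \<Longrightarrow> p (X \<union> Y) = p X \<oplus>\<^bsub>C\<^esub> p Y \<ominus>\<^bsub>C\<^esub> p (X \<inter> Y)"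
    and "X \<in> B \<Longrightarrow> a \<in> Al \<Longrightarrow> p X \<otimes>\<^bsub>C\<^esub> s a = s a \<otimes>\<^bsub>C\<^esub> p (rel_range E L X [a])"
    and "a \<in> Al \<Longrightarrow> star C (s a) \<otimes>\<^bsub>C\<^esub> s a = p (word_range E L [a])"
    and "a \<in> Al \<Longrightarrow> b \<in> Al \<Longrightarrow> a \<noteq> b \<Longrightarrow> star C (s a) \<otimes>\<^bsub>C\<^esub> s b = \<zero>\<^bsub>C\<^esub>"
    and "X \<in> B \<Longrightarrow> finite (L ` arcs_from E X) \<Longrightarrow> L ` arcs_from E X \<noteq> {} \<Longrightarrow>
        p X = (\<Oplus>\<^bsub>C\<^esub>a\<in>L ` arcs_from E X.
          s a \<otimes>\<^bsub>C\<^esub> p (rel_range E L X [a]) \<otimes>\<^bsub>C\<^esub> star C (s a))"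
proof -
  note r = assms[unfolded representation_def]
  show "X \<in> B \<Longrightarrow> is_projection C (p X)"
    by (rule r[THEN conjunct1, rule_format])
  show "a \<in> Al \<Longrightarrow> is_partial_isometry C (s a)"
    by (rule r[THEN conjunct2, THEN conjunct1, rule_format])
  show "p {} = \<zero>\<^bsub>C\<^esub>"
    by (rule r[THEN conjunct2, THEN conjunct2, THEN conjunct1, rule_format])
  show "X \<in> B \<Longrightarrow> Y \<in> B \<Longrightarrow> p X \<otimes>\<^bsub>C\<^esub> p Y = p (X \<inter> Y)"
    by (rule r[THEN conjunct2, THEN conjunct2, THEN conjunct2, THEN conjunct1, rule_format])
  show "X \<in> B \<Longrightarrow> Y \<in> B \<Longrightarrow> p (X \<union> Y) = p X \<oplus>\<^bsub>C\<^esub> p Y \<ominus>\<^bsub>C\<^esub> p (X \<inter> Y)"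
    by (rule r[THEN conjunct2, THEN conjunct2, THEN conjunct2, THEN conjunct2, THEN conjunct1, rule_format])
  show "X \<in> B \<Longrightarrow> a \<in> Al \<Longrightarrow> p X \<otimes>\<^bsub>C\<^esub> s a = s a \<otimes>\<^bsub>C\<^esub> p (rel_range E L X [a])"
    by (rule r[THEN conjunct2, THEN conjunct2, THEN conjunct2, THEN conjunct2, THEN conjunct2, THEN conjunct1, rule_format])
  show "a \<in> Al \<Longrightarrow> star C (s a) \<otimes>\<^bsub>C\<^esub> s a = p (word_range E L [a])"
    by (rule r[THEN conjunct2, THEN conjunct2, THEN conjunct2, THEN conjunct2, THEN conjunct2, THEN conjunct2, THEN conjunct1, rule_format])
  show "a \<in> Al \<Longrightarrow> b \<in> Al \<Longrightarrow> a \<noteq> b \<Longrightarrow> star C (s a) \<otimes>\<^bsub>C\<^esub> s b = \<zero>\<^bsub>C\<^esub>"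
    by (rule r[THEN conjunct2, THEN conjunct2, THEN conjunct2, THEN conjunct2, THEN conjunct2, THEN conjunct2, THEN conjunct2, THEN conjunct1, rule_format])
  show "X \<in> B \<Longrightarrow> finite (L ` arcs_from E X) \<Longrightarrow> L ` arcs_from E X \<noteq> {} \<Longrightarrow>
        p X = (\<Oplus>\<^bsub>C\<^esub>a\<in>L ` arcs_from E X.
          s a \<otimes>\<^bsub>C\<^esub> p (rel_range E L X [a]) \<otimes>\<^bsub>C\<^esub> star C (s a))"
    by (rule r[THEN conjunct2, THEN conjunct2, THEN conjunct2, THEN conjunct2, THEN conjunct2, THEN conjunct2, THEN conjunct2, THEN conjunct2, rule_format], assumption, rule conjI)
qed

lemma representation_mono:
  assumes "representation E L Al B' C p s" "B \<subseteq> B'"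
  shows "representation E L Al B C p s"
  unfolding representation_def
proof (intro conjI ballI impI)
  fix X assume "X \<in> B" "finite (L ` arcs_from E X) \<and> L ` arcs_from E X \<noteq> {}"
  then show "p X = (\<Oplus>\<^bsub>C\<^esub>a\<in>L ` arcs_from E X.
      s a \<otimes>\<^bsub>C\<^esub> p (rel_range E L X [a]) \<otimes>\<^bsub>C\<^esub> star C (s a))"
    using assms(2) by (intro representationD(9)[OF assms(1)]) auto
qed (rule representationD(1-8)[OF assms(1)]; use subsetD[OF assms(2)] in blast)+

lemma projection_lattice_representation:
  assumes "cstar_algebra C" "accommodating E L B" "representation E L Al B C p s"
  shows "projection_lattice C B p"
proof (intro projection_lattice.intro projection_lattice_axioms.intro)
  show "{} \<in> B" using assms(2) by (rule accommodatingD)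
  show "X \<union> Y \<in> B" "X \<inter> Y \<in> B" if "X \<in> B" "Y \<in> B" for X Y
    using accommodatingD(5,6)[OF assms(2) that] by auto
qed (rule assms(1) representationD[OF assms(3)]; assumption)+

lemma (in labelled_graph) letter_in_label_words:
  assumes "a \<in> Al"
  shows "[a] \<in> label_words E L"
proof -
  obtain e where e: "e \<in> arcs E" "L e = a" using assms label_surj by auto
  have "awalk (tail E e) [e] (head E e)" using e(1) by (rule arc_implies_awalk)
  then have "map L [e] \<in> label_words E L" unfolding label_words_def by blast
  then show ?thesis using e(2) by simp
qed

lemma (in labelled_graph) rel_range_letter_empty:
  assumes "a \<notin> L ` arcs_from E X"
  shows "rel_range E L X [a] = {}"
proof -
  have False if "awalk u q v" "map L q = [a]" "u \<in> X" for u q v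
  proof -
    obtain e where "q = [e]" "L e = a" using \<open>map L q = [a]\<close> by (cases q) auto
    then show False using that assms by (auto simp: awalk_simps arcs_from_def)
  qed
  then show ?thesis
    unfolding rel_range_def by (intro equals0I) (elim CollectE exE conjE)
qed

section \<open>Extending a representation to \<open>Ebar\<close>\<close>

locale labelled_space_representation = labelled_graph E L Al + cstar_algebra C
  for E :: "('v, 'e) pre_digraph" and L :: "'e \<Rightarrow> 'l" and Al :: "'l set"
    and C :: "'c star_algebra" (structure) +
  fixes p :: "'v set \<Rightarrow> 'c" and s :: "'l \<Rightarrow> 'c"
  assumes sf: "set_finite E L (E0minus E L)"
    and wlr: "weakly_left_resolving E L (Ebar E L)"
    and rep: "representation E L Al (E0minus E L) C p s"
begin

sublocale projection_lattice C "E0minus E L" p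
  using cstar_algebra_axioms accommodating_E0minus rep by (rule projection_lattice_representation)

lemma s_closed [simp]: "a \<in> Al \<Longrightarrow> s a \<in> carrier C"
  using representationD(2)[OF rep] by (simp add: is_partial_isometry_def)

lemmas E0minus_accommodating = accommodatingD[OF accommodating_E0minus[of L]]
lemmas Ebar_accommodating = accommodatingD[OF accommodating_Ebar(1)[of L]]
lemmas Ebar_Diff = accommodating_Ebar(2)[of _ L]

lemma extends_to_in_Ebar: "extends_to Z x \<Longrightarrow> Z \<in> Ebar E L"
proof (induction rule: extends_to.induct)
  case (disjoint_union Z x W y)
  then show ?case by (intro Ebar_accommodating(5))
next
  case (base X)
  then show ?case using E0minus_subset_Ebar by blast
next
  case (diff Z x W y)
  then show ?case by (intro Ebar_Diff)
qed

lemma extends_to_rel_range: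
  "extends_to Z x \<Longrightarrow> \<alpha> \<in> label_words E L \<Longrightarrow> \<exists>x'. extends_to (rel_range E L Z \<alpha>) x'"
proof (induction rule: extends_to.induct)
  case (base X)
  then have "rel_range E L X \<alpha> \<in> E0minus E L"
    using E0minus_accommodating(4) by simp
  then show ?case using extends_to.base by blast
next
  case (disjoint_union Z x W y)
  then obtain x' y' where "extends_to (rel_range E L Z \<alpha>) x'" "extends_to (rel_range E L W \<alpha>) y'"
    by blast
  from extends_to_Un[OF this] show ?case unfolding rel_range_Un by blast
next
  case (diff Z x W y)
  have "rel_range E L (Z - W) \<alpha> = rel_range E L Z \<alpha> - rel_range E L W \<alpha>"
    using diff.prems extends_to_in_Ebar[OF diff.hyps(1)] extends_to_in_Ebar[OF diff.hyps(2)]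
      Ebar_Diff
    by (intro weakly_left_resolving_Diff[OF wlr]) auto
  moreover obtain x' y' where "extends_to (rel_range E L Z \<alpha>) x'" "extends_to (rel_range E L W \<alpha>) y'"
    using diff.IH diff.prems by blast
  ultimately show ?case by (simp only:) (rule exI, rule extends_to.diff)
qed

text \<open>
  The sets that have a value form an accommodating family closed under differences, and \<^const>\<open>Ebar\<close>
  is the least such family.
\<close>

lemma Ebar_extends_to: "Z \<in> Ebar E L \<Longrightarrow> \<exists>x. extends_to Z x"
proof -
  define R where "R = {Z. \<exists>x. extends_to Z x}"
  have R_Ebar: "R \<subseteq> Ebar E L" unfolding R_def by (blast intro: extends_to_in_Ebar)
  have base_R: "E0minus E L \<subseteq> R" unfolding R_def by (blast intro: base)
  have "accommodating E L R"
    unfolding accommodating_def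
  proof (intro conjI ballI)
    show "R \<subseteq> Pow (verts E)"
      using R_Ebar Ebar_accommodating(1) by (rule order_trans)
    show "{} \<in> R" using B_empty base_R by blast
    show "word_range E L \<alpha> \<in> R" if "\<alpha> \<in> label_words E L" for \<alpha>
      using E0minus_accommodating(3)[OF that] base_R by (rule rev_subsetD)
    show "rel_range E L X \<alpha> \<in> R" if "X \<in> R" "\<alpha> \<in> label_words E L" for X \<alpha>
      using that extends_to_rel_range[of X _ \<alpha>] unfolding R_def by blast
    show "X \<union> Y \<in> R" if "X \<in> R" "Y \<in> R" for X Y
      using that unfolding R_def by (blast intro: extends_to_Un)
    show "X \<inter> Y \<in> R" if "X \<in> R" "Y \<in> R" for X Y
      using that unfolding R_def by (blast intro: extends_to_Int)
  qed
  moreover have "X - Y \<in> R" if "X \<in> R" "Y \<in> R" for X Y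
    using that unfolding R_def by (blast intro: extends_to.diff)
  ultimately have "Ebar E L \<subseteq> R" unfolding Ebar_def by blast
  then show "Z \<in> Ebar E L \<Longrightarrow> \<exists>x. extends_to Z x" by (auto simp: R_def)
qed

definition pbar :: "'v set \<Rightarrow> 'c" where
  "pbar Z = (THE x. extends_to Z x)"

lemma pbar_eq: "extends_to Z x \<Longrightarrow> pbar Z = x"
  unfolding pbar_def using extends_to_unique by blast

lemma extends_to_pbar: "Z \<in> Ebar E L \<Longrightarrow> extends_to Z (pbar Z)"
  using Ebar_extends_to pbar_eq by blast

lemma pbar_closed [simp]: "Z \<in> Ebar E L \<Longrightarrow> pbar Z \<in> carrier C"
  using extends_to_pbar extends_to_closed by blast

lemma pbar_base: "X \<in> E0minus E L \<Longrightarrow> pbar X = p X"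
  by (rule pbar_eq) (rule base)

lemma pbar_Int: "Z \<in> Ebar E L \<Longrightarrow> W \<in> Ebar E L \<Longrightarrow> pbar Z \<otimes> pbar W = pbar (Z \<inter> W)"
  using pbar_eq[OF extends_to_Int[OF extends_to_pbar extends_to_pbar]] by simp

lemma Ebar_rel_range: "Z \<in> Ebar E L \<Longrightarrow> a \<in> Al \<Longrightarrow> rel_range E L Z [a] \<in> Ebar E L"
  by (intro Ebar_accommodating(4) letter_in_label_words)

text \<open>
  The relation passes through products and differences of values, because relative ranges commute
  with intersections and differences.
\<close>

lemma pbar_covariant:
  assumes a: "a \<in> Al"
  shows "extends_to Z x \<Longrightarrow> x \<otimes> s a = s a \<otimes> pbar (rel_range E L Z [a])"
proof (induction rule: extends_to.induct)
  case (base X)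
  have "rel_range E L X [a] \<in> E0minus E L"
    using base a by (intro E0minus_accommodating(4) letter_in_label_words)
  then show ?case using representationD(6)[OF rep base a] by (simp add: pbar_base)
next
  case (disjoint_union Z x W y)
  have c: "x \<in> carrier C" "y \<in> carrier C" using disjoint_union extends_to_closed by auto
  have ZW: "Z \<in> Ebar E L" "W \<in> Ebar E L" using disjoint_union extends_to_in_Ebar by auto
  define Z' W' where "Z' = rel_range E L Z [a]" and "W' = rel_range E L W [a]"
  have ZW': "Z' \<in> Ebar E L" "W' \<in> Ebar E L" using Ebar_rel_range ZW a by (auto simp: Z'_def W'_def)
  have "Z' \<inter> W' = rel_range E L (Z \<inter> W) [a]"
    using wlr ZW letter_in_label_words[OF a] unfolding weakly_left_resolving_def Z'_def W'_def by blast
  then have disj: "Z' \<inter> W' = {}" using disjoint_union by simp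
  then have orth: "pbar Z' \<otimes> pbar W' = \<zero>"
    using ZW' B_empty by (simp add: pbar_Int pbar_base p_empty)
  have "pbar (Z' \<union> W') = pbar Z' \<oplus> pbar W'"
    by (rule pbar_eq[OF extends_to.disjoint_union[OF extends_to_pbar[OF ZW'(1)]
          extends_to_pbar[OF ZW'(2)] disj orth]])
  then show ?case
    using disjoint_union.IH c ZW' a
    by (simp add: rel_range_Un Z'_def[symmetric] W'_def[symmetric] mult_l_distr mult_r_distr)
next
  case (diff Z x W y)
  have c: "x \<in> carrier C" "y \<in> carrier C" using diff extends_to_closed by auto
  have ZW: "Z \<in> Ebar E L" "W \<in> Ebar E L" using diff extends_to_in_Ebar by auto
  define Z' W' where "Z' = rel_range E L Z [a]" and "W' = rel_range E L W [a]"
  have ZW': "Z' \<in> Ebar E L" "W' \<in> Ebar E L" using Ebar_rel_range ZW a by (auto simp: Z'_def W'_def)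
  have "rel_range E L (Z - W) [a] = Z' - W'"
    using ZW Ebar_Diff letter_in_label_words[OF a] unfolding Z'_def W'_def
    by (intro weakly_left_resolving_Diff[OF wlr]) auto
  then have r: "pbar (rel_range E L (Z - W) [a]) = pbar Z' \<ominus> pbar Z' \<otimes> pbar W'"
    using pbar_eq[OF extends_to.diff[OF extends_to_pbar[OF ZW'(1)] extends_to_pbar[OF ZW'(2)]]]
    by simp
  have IH: "x \<otimes> s a = s a \<otimes> pbar Z'" "y \<otimes> s a = s a \<otimes> pbar W'"
    using diff.IH by (simp_all add: Z'_def W'_def)
  have "x \<otimes> y \<otimes> s a = (x \<otimes> s a) \<otimes> pbar W'"
    using c ZW' a by (simp add: mult_assoc IH(2))
  then have "x \<otimes> y \<otimes> s a = s a \<otimes> (pbar Z' \<otimes> pbar W')"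
    using c ZW' a by (simp add: mult_assoc IH(1))
  then show ?case
    using c ZW' a by (simp add: r IH(1) minus_eq mult_l_distr mult_r_distr l_minus r_minus)
qed

text \<open>
  Choose \<open>X\<close> in \<open>\<E>\<^sup>0\<^sup>,\<^sup>-\<close> above \<open>Z\<close> and multiply the expansion of \<open>p X\<close> by \<open>pbar Z\<close> from the left.
  Covariance moves \<open>pbar Z\<close> past \<open>s a\<close>, where it is absorbed into the range projection; labels that
  no arc from \<open>Z\<close> carries contribute zero.
\<close>

lemma pbar_decomposition:
  assumes Z: "Z \<in> Ebar E L" and ne: "L ` arcs_from E Z \<noteq> {}"
  shows "pbar Z = (\<Oplus>a\<in>L ` arcs_from E Z. s a \<otimes> pbar (rel_range E L Z [a]) \<otimes> star C (s a))"
proof -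
  obtain X where X: "X \<in> E0minus E L" "Z \<subseteq> X" "p X \<otimes> pbar Z = pbar Z"
    using extends_to_bounded[OF extends_to_pbar[OF Z]] by blast
  let ?LZ = "L ` arcs_from E Z" and ?LX = "L ` arcs_from E X"
  have Xbar: "X \<in> Ebar E L" using X(1) E0minus_subset_Ebar by blast
  have sub: "?LZ \<subseteq> ?LX" using X(2) by (auto simp: arcs_from_def)
  have fin: "finite ?LX" using sf X(1) by (simp add: set_finite_def)
  have Al: "a \<in> Al" if "a \<in> ?LX" for a using that label_surj by (auto simp: arcs_from_def)
  have XE: "rel_range E L X [a] \<in> E0minus E L" if "a \<in> Al" for a
    using X(1) that by (intro E0minus_accommodating(4) letter_in_label_words)
  have pX: "p X = (\<Oplus>a\<in>?LX. s a \<otimes> p (rel_range E L X [a]) \<otimes> star C (s a))"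
    using representationD(9)[OF rep X(1) fin] ne sub by blast
  have summand: "pbar Z \<otimes> (s a \<otimes> p (rel_range E L X [a]) \<otimes> star C (s a))
      = s a \<otimes> pbar (rel_range E L Z [a]) \<otimes> star C (s a)" if "a \<in> ?LX" for a
  proof -
    have a: "a \<in> Al" by (rule Al[OF that])
    have "pbar (rel_range E L Z [a]) \<otimes> p (rel_range E L X [a])
        = pbar (rel_range E L Z [a] \<inter> rel_range E L X [a])"
      using pbar_Int Ebar_rel_range[OF Z a] Ebar_rel_range[OF Xbar a] pbar_base[OF XE[OF a]] by metis
    also have "rel_range E L Z [a] \<inter> rel_range E L X [a] = rel_range E L Z [a]"
      using rel_range_mono[OF X(2)] by blast
    finally have absorb: "pbar (rel_range E L Z [a]) \<otimes> p (rel_range E L X [a])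
        = pbar (rel_range E L Z [a])" .
    have "pbar Z \<otimes> (s a \<otimes> p (rel_range E L X [a]) \<otimes> star C (s a))
        = (pbar Z \<otimes> s a) \<otimes> p (rel_range E L X [a]) \<otimes> star C (s a)"
      using Z a XE by (simp add: mult_assoc)
    also have "\<dots> = s a \<otimes> (pbar (rel_range E L Z [a]) \<otimes> p (rel_range E L X [a])) \<otimes> star C (s a)"
      using pbar_covariant[OF a extends_to_pbar[OF Z]] Ebar_rel_range[OF Z a] a XE
      by (simp add: mult_assoc)
    finally show ?thesis by (simp only: absorb)
  qed
  have "pbar Z = pbar Z \<otimes> p X"
    using X(3) extends_to_commute_base[OF extends_to_pbar[OF Z] X(1)] by simp
  also have "\<dots> = (\<Oplus>a\<in>?LX. pbar Z \<otimes> (s a \<otimes> p (rel_range E L X [a]) \<otimes> star C (s a)))"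
    unfolding pX using Z Al XE by (intro mult_finsum fin) auto
  also have "\<dots> = (\<Oplus>a\<in>?LX. s a \<otimes> pbar (rel_range E L Z [a]) \<otimes> star C (s a))"
    using Al Ebar_rel_range[OF Z] summand by (intro finsum_cong') auto
  also have "\<dots> = (\<Oplus>a\<in>?LZ. s a \<otimes> pbar (rel_range E L Z [a]) \<otimes> star C (s a))"
    using fin sub Al Ebar_rel_range[OF Z] B_empty
    by (intro add.finprod_mono_neutral_cong_right)
      (auto simp: rel_range_letter_empty pbar_base p_empty)
  finally show ?thesis .
qed

theorem representation_pbar: "representation E L Al (Ebar E L) C pbar s"
  unfolding representation_def
proof (intro conjI ballI impI)
  fix X assume X: "X \<in> Ebar E L"
  show "is_projection C (pbar X)"
    using extends_to_projection[OF extends_to_pbar[OF X]] X by (simp add: is_projection_def)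
  show "pbar X \<otimes> s a = s a \<otimes> pbar (rel_range E L X [a])" if "a \<in> Al" for a
    using pbar_covariant[OF that extends_to_pbar[OF X]] .
  fix Y assume Y: "Y \<in> Ebar E L"
  show "pbar X \<otimes> pbar Y = pbar (X \<inter> Y)" using X Y by (rule pbar_Int)
  show "pbar (X \<union> Y) = pbar X \<oplus> pbar Y \<ominus> pbar (X \<inter> Y)"
    using pbar_eq[OF extends_to_Un[OF extends_to_pbar[OF X] extends_to_pbar[OF Y]]]
    by (simp add: pbar_Int X Y)
next
  fix X assume X: "X \<in> Ebar E L" and fin: "finite (L ` arcs_from E X) \<and> L ` arcs_from E X \<noteq> {}"
  show "pbar X = (\<Oplus>a\<in>L ` arcs_from E X. s a \<otimes> pbar (rel_range E L X [a]) \<otimes> star C (s a))"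
    using pbar_decomposition[OF X] fin by blast
next
  fix a assume a: "a \<in> Al"
  show "is_partial_isometry C (s a)" using representationD(2)[OF rep a] .
  have "word_range E L [a] \<in> E0minus E L"
    using a by (intro E0minus_accommodating(3) letter_in_label_words)
  then show "star C (s a) \<otimes> s a = pbar (word_range E L [a])"
    using representationD(7)[OF rep a] by (simp add: pbar_base)
  show "star C (s a) \<otimes> s b = \<zero>" if "b \<in> Al" "a \<noteq> b" for b
    using representationD(8)[OF rep a that] .
next
  show "pbar {} = \<zero>" using B_empty by (simp add: pbar_base p_empty)
qed

text \<open>
  The values of \<open>q\<close> on differences and disjoint unions are determined by the same formulas as in
  \<^const>\<open>extends_to\<close>.
\<close>

lemma star_hom_extends_to:
  assumes D: "cstar_algebra D" and q: "representation E L Al (Ebar E L) D q t"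
    and \<phi>: "star_hom C D \<phi>" and eq: "\<And>X. X \<in> E0minus E L \<Longrightarrow> \<phi> (p X) = q X"
  shows "extends_to Z x \<Longrightarrow> \<phi> x = q Z"
proof (induction rule: extends_to.induct)
  case (base X)
  then show ?case by (rule eq)
next
  interpret D: cstar_algebra D by fact
  note qD = representationD[OF q]
  case (disjoint_union Z x W y)
  have c: "x \<in> carrier C" "y \<in> carrier C" using disjoint_union extends_to_closed by auto
  have ZW: "Z \<in> Ebar E L" "W \<in> Ebar E L" using disjoint_union extends_to_in_Ebar by auto
  have "q Z \<in> carrier D" "q W \<in> carrier D" using qD(1) ZW by (auto simp: is_projection_def)
  then have "q (Z \<union> W) = q Z \<oplus>\<^bsub>D\<^esub> q W"
    using qD(5)[OF ZW] qD(3) disjoint_union(3) by (simp add: D.minus_eq)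
  then show ?case using disjoint_union.IH c \<phi> by (simp add: star_hom_def)
next
  interpret D: cstar_algebra D by fact
  note qD = representationD[OF q]
  case (diff Z x W y)
  have c: "x \<in> carrier C" "y \<in> carrier C" using diff extends_to_closed by auto
  have ZW: "Z \<in> Ebar E L" "W \<in> Ebar E L" using diff extends_to_in_Ebar by auto
  have ZW': "Z - W \<in> Ebar E L" "Z \<inter> W \<in> Ebar E L"
    using Ebar_Diff[OF ZW] Ebar_accommodating(6)[OF ZW] by auto
  have qc: "q V \<in> carrier D" if "V \<in> Ebar E L" for V using qD(1) that by (auto simp: is_projection_def)
  have "(Z - W) \<union> (Z \<inter> W) = Z" "(Z - W) \<inter> (Z \<inter> W) = {}" by blast+
  then have "q Z = q (Z - W) \<oplus>\<^bsub>D\<^esub> q (Z \<inter> W)"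
    using qD(5)[OF ZW'] qD(3) qc ZW' by (simp add: D.minus_eq)
  then have "q (Z - W) = q Z \<ominus>\<^bsub>D\<^esub> q Z \<otimes>\<^bsub>D\<^esub> q W"
    using qc ZW ZW' qD(4)[OF ZW] by (simp add: D.minus_eq D.a_assoc D.r_neg)
  moreover have "\<phi> (x \<otimes> y) = \<phi> x \<otimes>\<^bsub>D\<^esub> \<phi> y" using \<phi> c by (simp add: star_hom_def)
  ultimately show ?case
    using star_hom_diff[OF cstar_algebra_axioms D \<phi> c(1), of "x \<otimes> y"] c diff.IH by simp
qed

end

section \<open>The isomorphism\<close>

theorem corollary2p5:
  fixes E :: "('v, 'e) pre_digraph" and L :: "'e \<Rightarrow> 'l" and Al :: "'l set"
    and C C' :: "'c star_algebra"
  assumes "labelled_graph E L Al"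
    and "no_sinks E"
    and "set_finite E L (E0minus E L)" and "receiver_set_finite E L (E0minus E L)"
    and "set_finite E L (Ebar E L)" and "receiver_set_finite E L (Ebar E L)"
    and "weakly_left_resolving E L (E0minus E L)"
    and "weakly_left_resolving E L (Ebar E L)"
    and "is_labelled_space_cstar E L Al (E0minus E L) C"
    and "is_labelled_space_cstar E L Al (Ebar E L) C'"
  shows "cstar_isomorphic C C'"
proof -
  have C: "cstar_algebra C" and C': "cstar_algebra C'"
    using assms(9,10) unfolding is_labelled_space_cstar_def by auto
  obtain p s where rep: "representation E L Al (E0minus E L) C p s"
    and gen: "cstar_generated C (p ` E0minus E L \<union> s ` Al) = carrier C"
    and univ: "\<And>(D :: 'c star_algebra) q t. cstar_algebra D \<Longrightarrow> representation E L Al (E0minus E L) D q t \<Longrightarrow>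
      \<exists>\<phi>. star_hom C D \<phi> \<and> (\<forall>X\<in>E0minus E L. \<phi> (p X) = q X) \<and> (\<forall>a\<in>Al. \<phi> (s a) = t a)"
    using assms(9) unfolding is_labelled_space_cstar_def by blast
  obtain p' s' where rep': "representation E L Al (Ebar E L) C' p' s'"
    and gen': "cstar_generated C' (p' ` Ebar E L \<union> s' ` Al) = carrier C'"
    and univ': "\<And>(D :: 'c star_algebra) q t. cstar_algebra D \<Longrightarrow> representation E L Al (Ebar E L) D q t \<Longrightarrow>
      \<exists>\<phi>. star_hom C' D \<phi> \<and> (\<forall>X\<in>Ebar E L. \<phi> (p' X) = q X) \<and> (\<forall>a\<in>Al. \<phi> (s' a) = t a)"
    using assms(10) unfolding is_labelled_space_cstar_def by blast
  interpret R: labelled_space_representation E L Al C p s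
    using assms(1,3,8) C rep
    by (intro labelled_space_representation.intro labelled_space_representation_axioms.intro)
  obtain \<phi> where \<phi>: "star_hom C C' \<phi>" "\<And>X. X \<in> E0minus E L \<Longrightarrow> \<phi> (p X) = p' X"
    "\<And>a. a \<in> Al \<Longrightarrow> \<phi> (s a) = s' a"
    using univ[OF C' representation_mono[OF rep' E0minus_subset_Ebar]] by blast
  obtain \<psi> where \<psi>: "star_hom C' C \<psi>" "\<And>X. X \<in> Ebar E L \<Longrightarrow> \<psi> (p' X) = R.pbar X"
    "\<And>a. a \<in> Al \<Longrightarrow> \<psi> (s' a) = s a"
    using univ'[OF C R.representation_pbar] by blast
  have \<phi>_pbar: "\<phi> (R.pbar X) = p' X" if "X \<in> Ebar E L" for X
    using R.star_hom_extends_to[OF C' rep' \<phi>(1,2) R.extends_to_pbar[OF that]] .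
  have "\<psi> (\<phi> x) = x" if "x \<in> carrier C" for x
  proof (rule star_hom_eq_on_generated[OF C C star_hom_comp[OF \<phi>(1) \<psi>(1)] star_hom_id])
    show "p ` E0minus E L \<union> s ` Al \<subseteq> carrier C" by auto
    show "\<psi> (\<phi> g) = g" if "g \<in> p ` E0minus E L \<union> s ` Al" for g
      using that E0minus_subset_Ebar[of E L] by (auto simp: \<phi> \<psi> R.pbar_base)
    show "x \<in> cstar_generated C (p ` E0minus E L \<union> s ` Al)" using that gen by simp
  qed
  moreover have "\<phi> (\<psi> y) = y" if "y \<in> carrier C'" for y
  proof (rule star_hom_eq_on_generated[OF C' C' star_hom_comp[OF \<psi>(1) \<phi>(1)] star_hom_id])
    show "p' ` Ebar E L \<union> s' ` Al \<subseteq> carrier C'"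
      using representationD(1,2)[OF rep'] by (auto simp: is_projection_def is_partial_isometry_def)
    show "\<phi> (\<psi> g) = g" if "g \<in> p' ` Ebar E L \<union> s' ` Al" for g
      using that by (auto simp: \<phi>(3) \<psi> \<phi>_pbar)
    show "y \<in> cstar_generated C' (p' ` Ebar E L \<union> s' ` Al)" using that gen' by simp
  qed
  moreover have "\<phi> x \<in> carrier C'" if "x \<in> carrier C" for x
    using \<phi>(1) that by (auto simp: star_hom_def)
  moreover have "\<psi> y \<in> carrier C" if "y \<in> carrier C'" for y
    using \<psi>(1) that by (auto simp: star_hom_def)
  ultimately have "bij_betw \<phi> (carrier C) (carrier C')"
    by (intro bij_betw_byWitness[of _ \<psi>]) auto
  then show ?thesis using \<phi>(1) by (auto simp: cstar_isomorphic_def)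
qed

end
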